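(* The Matching Cut problem can be solved in time $O(|V|\cdot|E|^3)$ when restricted to bipartite graphs $G=(V,E)$ of diameter at most $3$.
   Context: All graphs are finite and simple. A cut of a graph $G=(V,E)$ is a partition $V=X\,\dot\cup\,Y$ into two disjoint non-empty sets $X,Y$. It is a matching cut if the set of edges with one endpoint in $X$ and the other in $Y$ is a (possibly empty) matching, equivalently each vertex of $X$ has at most one neighbor in $Y$ and each vertex of $Y$ has at most one neighbor in $X$. The Matching Cut problem: given a graph $G$, decide whether $G$ has a matching cut. The diameter of a connected graph is the maximum over all pairs of vertices of the length of a shortest path between them. *)

theory Defs
  imports Main "HOL-Library.Disjoint_Sets"
begin

section \<open>Graphs\<close>

definition simple_graph :: "'a set \<Rightarrow> 'a set set \<Rightarrow> bool" where
  "simple_graph V E \<longleftrightarrow> finite V \<and> (\<forall>e\<in>E. \<exists>u\<in>V. \<exists>v\<in>V. u \<noteq> v \<and> e = {u, v})"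

definition bipartite :: "'a set \<Rightarrow> 'a set set \<Rightarrow> bool" where
  "bipartite V E \<longleftrightarrow>
     (\<exists>A B. A \<union> B = V \<and> A \<inter> B = {} \<and> (\<forall>e\<in>E. \<exists>a\<in>A. \<exists>b\<in>B. e = {a, b}))"

definition graph_path :: "'a set \<Rightarrow> 'a set set \<Rightarrow> 'a \<Rightarrow> 'a list \<Rightarrow> 'a \<Rightarrow> bool" where
  "graph_path V E u p v \<longleftrightarrow>
     p \<noteq> [] \<and> hd p = u \<and> last p = v \<and> set p \<subseteq> V \<and> distinct p \<and>
     successively (\<lambda>x y. {x, y} \<in> E) p"

definition graph_connected :: "'a set \<Rightarrow> 'a set set \<Rightarrow> bool" where
  "graph_connected V E \<longleftrightarrow> V \<noteq> {} \<and> (\<forall>u\<in>V. \<forall>v\<in>V. \<exists>p. graph_path V E u p v)"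

definition graph_dist :: "'a set \<Rightarrow> 'a set set \<Rightarrow> 'a \<Rightarrow> 'a \<Rightarrow> nat" where
  "graph_dist V E u v = (LEAST k. \<exists>p. graph_path V E u p v \<and> length p = Suc k)"

text \<open>Only meaningful for finite connected graphs.\<close>

definition diameter :: "'a set \<Rightarrow> 'a set set \<Rightarrow> nat" where
  "diameter V E = Max {graph_dist V E u v | u v. u \<in> V \<and> v \<in> V}"

definition is_cut :: "'a set \<Rightarrow> 'a set \<Rightarrow> 'a set \<Rightarrow> bool" where
  "is_cut V X Y \<longleftrightarrow> X \<union> Y = V \<and> X \<inter> Y = {} \<and> X \<noteq> {} \<and> Y \<noteq> {}"

definition cut_edges :: "'a set set \<Rightarrow> 'a set \<Rightarrow> 'a set \<Rightarrow> 'a set set" where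
  "cut_edges E X Y = {e \<in> E. \<exists>x\<in>X. \<exists>y\<in>Y. e = {x, y}}"

text \<open>\<^const>\<open>disjoint\<close> says that the edges are pairwise disjoint, i.e. that they form a
  matching.\<close>

definition matching_cut :: "'a set \<Rightarrow> 'a set set \<Rightarrow> 'a set \<Rightarrow> 'a set \<Rightarrow> bool" where
  "matching_cut V E X Y \<longleftrightarrow> is_cut V X Y \<and> disjoint (cut_edges E X Y)"

definition has_matching_cut :: "'a set \<Rightarrow> 'a set set \<Rightarrow> bool" where
  "has_matching_cut V E \<longleftrightarrow> (\<exists>X Y. matching_cut V E X Y)"


section \<open>A uniform-cost random access machine\<close>

text \<open>
  Programs are structured programs for a random access machine with natural number registers
  and a memory indexed by the natural numbers. The only arithmetic operations are addition and
  truncated subtraction; there is no multiplication, so that unit cost per operation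
  is the usual uniform cost criterion. A state consists of the registers and the memory.
\<close>

type_synonym state = "(nat \<Rightarrow> nat) \<times> (nat \<Rightarrow> nat)"

datatype expr =
    Const nat
  | Reg nat
  | Mem expr
  | Plus expr expr
  | Minus expr expr

datatype test =
    Less expr expr
  | Equal expr expr
  | Neg test
  | Conj test test

datatype prog =
    Skip
  | SetReg nat expr
  | SetMem expr expr
  | Seq prog prog
  | If test prog prog
  | While test prog

primrec expr_val :: "expr \<Rightarrow> state \<Rightarrow> nat" where
  "expr_val (Const k) s = k"
| "expr_val (Reg r) s = fst s r"
| "expr_val (Mem a) s = snd s (expr_val a s)"
| "expr_val (Plus a b) s = expr_val a s + expr_val b s"
| "expr_val (Minus a b) s = expr_val a s - expr_val b s"

primrec expr_cost :: "expr \<Rightarrow> nat" where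
  "expr_cost (Const k) = 1"
| "expr_cost (Reg r) = 1"
| "expr_cost (Mem a) = expr_cost a + 1"
| "expr_cost (Plus a b) = expr_cost a + expr_cost b + 1"
| "expr_cost (Minus a b) = expr_cost a + expr_cost b + 1"

primrec test_val :: "test \<Rightarrow> state \<Rightarrow> bool" where
  "test_val (Less a b) s \<longleftrightarrow> expr_val a s < expr_val b s"
| "test_val (Equal a b) s \<longleftrightarrow> expr_val a s = expr_val b s"
| "test_val (Neg b) s \<longleftrightarrow> \<not> test_val b s"
| "test_val (Conj b c) s \<longleftrightarrow> test_val b s \<and> test_val c s"

primrec test_cost :: "test \<Rightarrow> nat" where
  "test_cost (Less a b) = expr_cost a + expr_cost b + 1"
| "test_cost (Equal a b) = expr_cost a + expr_cost b + 1"
| "test_cost (Neg b) = test_cost b + 1"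
| "test_cost (Conj b c) = test_cost b + test_cost c + 1"

text \<open>\<open>exec c s t s'\<close>: started in \<open>s\<close>, the program \<open>c\<close> halts in \<open>s'\<close> after \<open>t\<close> steps.\<close>

inductive exec :: "prog \<Rightarrow> state \<Rightarrow> nat \<Rightarrow> state \<Rightarrow> bool" where
  Skip: "exec Skip s 1 s"
| SetReg: "exec (SetReg r a) s (expr_cost a + 1) ((fst s)(r := expr_val a s), snd s)"
| SetMem: "exec (SetMem a b) s (expr_cost a + expr_cost b + 1)
             (fst s, (snd s)(expr_val a s := expr_val b s))"
| Seq: "exec c s t s' \<Longrightarrow> exec d s' t' s'' \<Longrightarrow> exec (Seq c d) s (t + t') s''"
| IfTrue: "test_val b s \<Longrightarrow> exec c s t s' \<Longrightarrow> exec (If b c d) s (test_cost b + t) s'"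
| IfFalse: "\<not> test_val b s \<Longrightarrow> exec d s t s' \<Longrightarrow> exec (If b c d) s (test_cost b + t) s'"
| WhileFalse: "\<not> test_val b s \<Longrightarrow> exec (While b c) s (test_cost b) s"
| WhileTrue: "test_val b s \<Longrightarrow> exec c s t s' \<Longrightarrow> exec (While b c) s' t' s''
     \<Longrightarrow> exec (While b c) s (test_cost b + t + t') s''"

inductive_cases exec_elims:
  "exec Skip s t s'"
  "exec (SetReg r a) s t s'"
  "exec (SetMem a b) s t s'"
  "exec (Seq c d) s t s'"
  "exec (If b c d) s t s'"
  "exec (While b c) s t s'"

lemma exec_deterministic:
  "exec c s t s' \<Longrightarrow> exec c s u s'' \<Longrightarrow> u = t \<and> s'' = s'"
proof (induction arbitrary: u s'' rule: exec.induct)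
  case (Seq c s t s' d t' s2)
  from Seq.prems obtain u1 u2 r where *: "u = u1 + u2" "exec c s u1 r" "exec d r u2 s''"
    by (rule exec_elims(4))
  with Seq.IH(1)[OF *(2)] Seq.IH(2)[of u2 s''] show ?case by simp
next
  case (WhileTrue b s c t s' t' s2)
  from WhileTrue.prems WhileTrue.hyps(1) obtain u1 u2 r where
    *: "u = test_cost b + u1 + u2" "exec c s u1 r" "exec (While b c) r u2 s''"
    by (erule_tac exec_elims(6)) simp_all
  with WhileTrue.IH(1)[OF *(2)] WhileTrue.IH(2)[of u2 s''] show ?case by simp
next
  case Skip then show ?case by (auto elim: exec_elims(1))
next
  case SetReg then show ?case by (auto elim: exec_elims(2))
next
  case SetMem then show ?case by (auto elim: exec_elims(3))
next
  case (IfTrue b s c t s' d)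
  from IfTrue.prems IfTrue.hyps(1) obtain u1 where
    *: "u = test_cost b + u1" "exec c s u1 s''"
    by (elim exec_elims(5)) simp_all
  with IfTrue.IH[OF *(2)] show ?case by simp
next
  case (IfFalse b s d t s' c)
  from IfFalse.prems IfFalse.hyps(1) obtain u1 where
    *: "u = test_cost b + u1" "exec d s u1 s''"
    by (elim exec_elims(5)) simp_all
  with IfFalse.IH[OF *(2)] show ?case by simp
next
  case (WhileFalse b s c)
  from WhileFalse.prems WhileFalse.hyps(1) show ?case
    by (erule_tac exec_elims(6)) simp_all
qed


section \<open>Graph problems and their time complexity\<close>

text \<open>
  Graphs are presented to a program with vertex set \<open>{..<n}\<close> and as a list of edges, in
  arbitrary order, each edge occurring once and with its endpoints in arbitrary order.
\<close>

definition edge_list :: "nat set set \<Rightarrow> (nat \<times> nat) list \<Rightarrow> bool" where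
  "edge_list E es \<longleftrightarrow>
     (\<lambda>(u, v). {u, v}) ` set es = E \<and> distinct (map (\<lambda>(u, v). {u, v}) es)"

text \<open>
  Initially register 0 contains the number of vertices, register 1 the number of edges, and the
  memory cells \<open>2 * i\<close> and \<open>2 * i + 1\<close> contain the endpoints of the \<open>i\<close>-th edge. All else is 0.
\<close>

definition input_state :: "nat \<Rightarrow> (nat \<times> nat) list \<Rightarrow> state" where
  "input_state n es =
     ((\<lambda>_. 0)(0 := n, 1 := length es),
      \<lambda>a. if a < 2 * length es
          then (if even a then fst (es ! (a div 2)) else snd (es ! (a div 2))) else 0)"

text \<open>
  \<open>solvable_in_time I Q f\<close>: one program decides \<open>Q\<close> on all graphs \<open>(V, E)\<close> satisfying \<open>I\<close> in time
  \<open>O(f |V| |E|)\<close>, leaving the answer in register 0. On graphs not satisfying \<open>I\<close> the program may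
  behave arbitrarily. As every run takes at least one step, inputs with \<open>f |V| |E| = 0\<close>
  (such as the graph with one vertex, if \<open>f |V| |E| = |V| * |E|\<close>) are allowed constant time.
\<close>

definition solvable_in_time ::
    "(nat set \<Rightarrow> nat set set \<Rightarrow> bool) \<Rightarrow> (nat set \<Rightarrow> nat set set \<Rightarrow> bool) \<Rightarrow>
     (nat \<Rightarrow> nat \<Rightarrow> nat) \<Rightarrow> bool" where
  "solvable_in_time I Q f \<longleftrightarrow>
     (\<exists>c C. \<forall>n E es. simple_graph {..<n} E \<and> I {..<n} E \<and> edge_list E es \<longrightarrow>
        (\<exists>t s. exec c (input_state n es) t s \<and>
               fst s 0 = (if Q {..<n} E then 1 else 0) \<and>
               t \<le> C * max 1 (f n (card E))))"

end

theory Submission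
  imports Defs
begin

text \<open>
  In a connected bipartite graph of diameter at most 3 any two vertices of the same side have a
  common neighbor. Fix a matching cut. Once the colors (sides of the cut) of some vertices are known,
  two rules force further ones: the other neighbors of a vertex with a known cut edge get its color,
  and a vertex with two neighbors of the same color gets that color. Common neighbors make this
  propagation so effective that, possibly after changing the cut, there are two cut edges from which
  all colors are forced except for vertices of one single color. The algorithm therefore tries all
  pairs of edges with all relevant colorings, propagates in at most \<open>|V|\<close> rounds of time
  \<open>O(|V| + |E|)\<close>, gives the remaining vertices one default color, and checks the result. As there are
  no isolated vertices, \<open>|V| \<le> 2 * |E|\<close>, which yields \<open>O(|E| * |E| * |V| * |E|)\<close>.
\<close>

section \<open>Forced colors\<close>

text \<open>The obstacle is that the closure of one cut edge can leave vertices of both colors open.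
  Vertices of degree 2 with neighbors of different colors are the worst: counting neighbors never
  decides them. Having pairwise common neighbors, they share a single neighbor, and an edge there
  settles them all; it is for this edge that one vertex may have to change its color. Otherwise both
  ends of every cut edge have degree at least 3, and the pigeonhole principle works: a vertex with
  neighbors of both colors has a cut edge, hence a third neighbor, hence two neighbors of one color.
  What remains is a dichotomy on whether some cut edge joins two open vertices. A wrong guess needs
  no treatment during propagation. Soundness comes from the final check alone; the structure of the
  graph is needed only for completeness, where some guess has to be right.\<close>

locale common_neighbor_graph =
  fixes V :: "'a set" and adj :: "'a \<Rightarrow> 'a \<Rightarrow> bool" and side :: "'a \<Rightarrow> bool"
  assumes adj_sym: "adj u v \<Longrightarrow> adj v u"
    and adj_in: "adj u v \<Longrightarrow> u \<in> V"
    and adj_side: "adj u v \<Longrightarrow> side u \<noteq> side v"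
    and common: "u \<in> V \<Longrightarrow> v \<in> V \<Longrightarrow> side u = side v \<Longrightarrow> u \<noteq> v \<Longrightarrow> \<exists>w. adj u w \<and> adj v w"
begin

text \<open>Constant colorings are included. That a cut is non-trivial is expressed separately, by
  an edge with ends of different colors.\<close>

definition matching_coloring :: "('a \<Rightarrow> bool) \<Rightarrow> bool" where
  "matching_coloring \<sigma> \<longleftrightarrow> (\<forall>v u w. adj v u \<longrightarrow> adj v w \<longrightarrow> \<sigma> u \<noteq> \<sigma> v \<longrightarrow> \<sigma> w \<noteq> \<sigma> v \<longrightarrow> u = w)"

text \<open>The rules consult \<open>\<sigma>\<close> only at vertices that are forced already, and
  for a matching coloring these colors determine the new one. So a program that knows only the
  colors on \<open>S\<close> can follow the closure. Below, a vertex whose cut edge has two forced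
  ends is called saturated (\<open>sat\<close> then forces all its neighbors), and an unforced
  vertex is called open.\<close>

inductive forced :: "('a \<Rightarrow> bool) \<Rightarrow> 'a set \<Rightarrow> 'a \<Rightarrow> bool" for \<sigma> S where
  base: "v \<in> S \<Longrightarrow> forced \<sigma> S v"
| sat: "forced \<sigma> S u \<Longrightarrow> forced \<sigma> S w \<Longrightarrow> adj u w \<Longrightarrow> \<sigma> u \<noteq> \<sigma> w \<Longrightarrow> adj u v \<Longrightarrow> forced \<sigma> S v"
| two: "forced \<sigma> S u \<Longrightarrow> forced \<sigma> S w \<Longrightarrow> u \<noteq> w \<Longrightarrow> \<sigma> u = \<sigma> w \<Longrightarrow> adj u v \<Longrightarrow> adj w v \<Longrightarrow> forced \<sigma> S v"

definition two_edges_suffice :: bool where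
  "two_edges_suffice \<longleftrightarrow> (\<exists>\<sigma> a b a' b' d. matching_coloring \<sigma> \<and> adj a b \<and> \<sigma> a \<noteq> \<sigma> b \<and> adj a' b' \<and> \<sigma> a' \<noteq> \<sigma> b' \<and>
     (\<forall>x\<in>V. forced \<sigma> {a, b, a', b'} x \<or> \<sigma> x = d))"

lemma suffice_twoI:
  "matching_coloring \<sigma> \<Longrightarrow> adj a b \<Longrightarrow> \<sigma> a \<noteq> \<sigma> b \<Longrightarrow> adj a' b' \<Longrightarrow> \<sigma> a' \<noteq> \<sigma> b' \<Longrightarrow>
   (\<And>x. x \<in> V \<Longrightarrow> \<sigma> x \<noteq> d \<Longrightarrow> forced \<sigma> {a, b, a', b'} x) \<Longrightarrow> two_edges_suffice"
  unfolding two_edges_suffice_def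
  by (rule exI[of _ \<sigma>], rule exI[of _ a], rule exI[of _ b], rule exI[of _ a'], rule exI[of _ b'],
      rule exI[of _ d]) auto

lemma suffice_oneI:
  "matching_coloring \<sigma> \<Longrightarrow> adj a b \<Longrightarrow> \<sigma> a \<noteq> \<sigma> b \<Longrightarrow>
   (\<And>x. x \<in> V \<Longrightarrow> \<sigma> x \<noteq> d \<Longrightarrow> forced \<sigma> {a, b} x) \<Longrightarrow> two_edges_suffice"
  by (rule suffice_twoI[of \<sigma> a b a b d]) (simp_all add: insert_commute)

lemma matching_coloringD: "matching_coloring \<sigma> \<Longrightarrow> adj v u \<Longrightarrow> adj v w \<Longrightarrow> \<sigma> u \<noteq> \<sigma> v \<Longrightarrow> \<sigma> w \<noteq> \<sigma> v \<Longrightarrow> u = w"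
  unfolding matching_coloring_def by blast

lemma same_color: "matching_coloring \<sigma> \<Longrightarrow> adj v u \<Longrightarrow> adj v w \<Longrightarrow> \<sigma> u \<noteq> \<sigma> v \<Longrightarrow> w \<noteq> u \<Longrightarrow> \<sigma> w = \<sigma> v"
  unfolding matching_coloring_def by blast

lemma adj_in': "adj u v \<Longrightarrow> v \<in> V"
  using adj_sym adj_in by blast

lemma forced_mono: "forced \<sigma> S x \<Longrightarrow> (\<And>y. y \<in> S \<Longrightarrow> forced \<sigma> T y) \<Longrightarrow> forced \<sigma> T x"
  by (induction rule: forced.induct) (blast intro: forced.intros)+

lemma forced_subset: "forced \<sigma> S x \<Longrightarrow> S \<subseteq> T \<Longrightarrow> forced \<sigma> T x"
  by (erule forced_mono) (blast intro: forced.intros)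

section \<open>Pendant vertices and cut edges with an end of degree 2\<close>

lemma pendant_suffices:
  assumes "adj v x" "\<And>z. adj v z \<Longrightarrow> z = x"
  shows two_edges_suffice
\<comment> \<open>The cut that isolates \<open>v\<close>; every other vertex has the default
  color.\<close>
proof (rule suffice_oneI[of "\<lambda>w. w = v" v x False])
  show "matching_coloring (\<lambda>w. w = v)" unfolding matching_coloring_def using assms(2) by blast
  show "(v = v) \<noteq> (x = v)" using assms(1) adj_side by blast
  show "forced (\<lambda>w. w = v) {v, x} y" if "(y = v) \<noteq> False" for y
    using that by (auto intro: forced.base)
qed (rule assms(1))

text \<open>The rule \<open>two\<close> cannot reach vertices of degree 2 whose neighbors differ in
  color, so one further edge has to force all of \<open>S\<close> at once. It does so by saturating
  a common neighbor \<open>c\<close> of \<open>S\<close>; if \<open>c\<close> has no cut edge,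
  moving one vertex of \<open>S\<close> to the other side of the cut creates one.\<close>

lemma star_suffices:
  assumes v: "matching_coloring \<sigma>" and ab: "adj a b" "\<sigma> a \<noteq> \<sigma> b"
    and S: "\<And>s. s \<in> S \<Longrightarrow> s \<in> V \<and> side s = h \<and> \<not> forced \<sigma> {a, b} s \<and>
              (\<exists>x y. \<sigma> x \<noteq> \<sigma> y \<and> (\<forall>z. adj s z \<longleftrightarrow> z = x \<or> z = y))"
    and cover: "\<And>x. x \<in> V \<Longrightarrow> \<sigma> x \<noteq> d \<Longrightarrow> x \<notin> S \<Longrightarrow> forced \<sigma> {a, b} x"
  shows two_edges_suffice
proof (cases "S = {}")
  case True
  with cover show ?thesis using suffice_oneI[OF v ab, of d] by blast
next
  case False
  then obtain s where s: "s \<in> S" by blast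
  from S[OF s] obtain x y where xy: "\<sigma> x \<noteq> \<sigma> y" "\<And>z. adj s z \<longleftrightarrow> z = x \<or> z = y" by blast
  have share: "\<exists>w. adj s' w \<and> adj s'' w" if "s' \<in> S" "s'' \<in> S" for s' s''
  proof (cases "s' = s''")
    case True then show ?thesis using S[OF that(1)] by blast
  next
    case False then show ?thesis using common S that by metis
  qed
  \<comment> \<open>Sets \<open>{x, y}\<close> with \<open>\<sigma> x \<noteq> \<sigma> y\<close> that pairwise intersect have a common element.\<close>
  have "\<exists>c. \<forall>s'\<in>S. adj c s'"
  proof (rule ccontr)
    assume none: "\<nexists>c. \<forall>s'\<in>S. adj c s'"
    then obtain s1 s2 where s1: "s1 \<in> S" "\<not> adj x s1" and s2: "s2 \<in> S" "\<not> adj y s2" by blast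
    have s1y: "adj s1 y" using share[OF s s1(1)] s1 xy adj_sym by metis
    have s2x: "adj s2 x" using share[OF s s2(1)] s2 xy adj_sym by metis
    obtain w where w: "adj s1 w" "adj s2 w" using share[OF s1(1) s2(1)] by blast
    \<comment> \<open>The three neighborhoods are now \<open>{x, y}\<close>, \<open>{y, w}\<close>
      and \<open>{x, w}\<close>; with two colors not all of them can contain both.\<close>
    have wn: "w \<noteq> x" "w \<noteq> y" using w s1 s2 adj_sym by blast+
    from S[OF s1(1)] have c1: "\<sigma> w \<noteq> \<sigma> y" using s1y w(1) wn by metis
    from S[OF s2(1)] have "\<sigma> w \<noteq> \<sigma> x" using s2x w(2) wn by metis
    with c1 xy(1) show False by blast
  qed
  then obtain c where c: "\<And>s'. s' \<in> S \<Longrightarrow> adj c s'" by blast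
  show ?thesis
  proof (cases "\<exists>z. adj c z \<and> \<sigma> c \<noteq> \<sigma> z")
    case True
    then obtain z where z: "adj c z" "\<sigma> c \<noteq> \<sigma> z" by blast
    show ?thesis
    proof (rule suffice_twoI[OF v ab z, of d])
      fix u assume u: "u \<in> V" "\<sigma> u \<noteq> d"
      show "forced \<sigma> {a, b, c, z} u"
      proof (cases "u \<in> S")
        case True
        show ?thesis
          by (rule forced.sat[of _ _ c z]) (use z c[OF True] in \<open>auto intro: forced.base\<close>)
      next
        case False
        from cover[OF u this] show ?thesis by (rule forced_subset) blast
      qed
    qed
  next
    case False
    \<comment> \<open>Flipping \<open>s\<close> turns its edge to \<open>c\<close> into the only cut edge at \<open>c\<close>.\<close>
    obtain y' where y': "\<And>z. adj s z \<longleftrightarrow> z = c \<or> z = y'" "\<sigma> c \<noteq> \<sigma> y'"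
      using xy c[OF s] adj_sym by metis
    define \<tau> where "\<tau> = \<sigma>(s := \<not> \<sigma> s)"
    have sc: "\<sigma> s = \<sigma> c" using False c[OF s] by blast
    have cs: "c \<noteq> s" "y' \<noteq> s" using c[OF s] adj_side y'(1) by blast+
    \<comment> \<open>The cut edge of \<open>s\<close> moves from \<open>y'\<close> to
      \<open>c\<close>: the vertex \<open>y'\<close> loses its only cut edge, and \<open>c\<close>
      had none before.\<close>
    have vt: "matching_coloring \<tau>"
      unfolding matching_coloring_def
    proof (intro allI impI)
      fix p u w assume *: "adj p u" "adj p w" "\<tau> u \<noteq> \<tau> p" "\<tau> w \<noteq> \<tau> p"
      consider "p = s" | "p = c" | "p = y'" | "p \<noteq> s" "u \<noteq> s" "w \<noteq> s"
        using * y'(1) adj_sym by blast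
      then show "u = w"
      proof cases
        case 1
        with * show ?thesis using y' sc cs by (auto simp: \<tau>_def)
      next
        case 2
        have "\<sigma> u = \<sigma> c" "\<sigma> w = \<sigma> c" using False *(1,2) 2 by blast+
        then have "u = s" "w = s" using *(3,4) 2 cs by (simp_all add: \<tau>_def split: if_splits)
        then show ?thesis by simp
      next
        case 3
        have "u \<noteq> s" "w \<noteq> s" using *(3,4) 3 y'(2) sc cs by (simp_all add: \<tau>_def split: if_splits)
        then show ?thesis using *(3,4) 3 cs matching_coloringD[OF v *(1,2)] by (simp add: \<tau>_def)
      next
        case 4
        then show ?thesis using *(3,4) matching_coloringD[OF v *(1,2)] by (simp add: \<tau>_def)
      qed
    qed
    \<comment> \<open>As \<open>s\<close> is open, no forcing step consults its color.\<close>
    have tr: "forced \<tau> {a, b} u" if "forced \<sigma> {a, b} u" for u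
      using that
    proof (induction rule: forced.induct)
      case (base v)
      then show ?case by (rule forced.base)
    next
      case (sat u w v)
      then have "\<tau> u = \<sigma> u" "\<tau> w = \<sigma> w" using S[OF s] by (auto simp: \<tau>_def)
      with sat show ?case by (intro forced.sat[of \<tau> _ u w v]) simp_all
    next
      case (two u w v)
      then have "\<tau> u = \<sigma> u" "\<tau> w = \<sigma> w" using S[OF s] by (auto simp: \<tau>_def)
      with two show ?case by (intro forced.two[of \<tau> _ u w v]) simp_all
    qed
    have nab: "a \<noteq> s" "b \<noteq> s" using S[OF s] by (auto intro: forced.base)
    show ?thesis
    proof (rule suffice_twoI[OF vt ab(1) _ c[OF s], of d])
      show "\<tau> a \<noteq> \<tau> b" using ab nab by (simp add: \<tau>_def)
      show cc: "\<tau> c \<noteq> \<tau> s" using sc cs by (simp add: \<tau>_def)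
      fix u assume u: "u \<in> V" "\<tau> u \<noteq> d"
      show "forced \<tau> {a, b, c, s} u"
      proof (cases "u \<in> S")
        case True
        show ?thesis
          by (rule forced.sat[of _ _ c s]) (use cc c[OF True] c[OF s] in \<open>auto intro: forced.base\<close>)
      next
        case False
        then have "\<sigma> u \<noteq> d" using u s by (auto simp: \<tau>_def split: if_splits)
        from tr[OF cover[OF u(1) this False]] show ?thesis by (rule forced_subset) blast
      qed
    qed
  qed
qed

text \<open>The default color is \<open>\<sigma> a\<close>. Since \<open>b\<close> is saturated,
  \<open>opp\<close> settles the vertices of color \<open>\<sigma> b\<close> on the side of
  \<open>a\<close>. An open vertex of this color on the side of \<open>b\<close> shares a neighbor
  of the same color with \<open>b\<close>; a second neighbor of this color would force it, so it has
  degree 2 and falls under \<open>star_suffices\<close>.\<close>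

lemma covered_side_suffices:
  assumes v: "matching_coloring \<sigma>" and ab: "adj a b" "\<sigma> a \<noteq> \<sigma> b"
    and mindeg: "\<And>u x. u \<in> V \<Longrightarrow> \<exists>z. adj u z \<and> z \<noteq> x"
    and opp: "\<And>r. r \<in> V \<Longrightarrow> side r = side a \<Longrightarrow> \<sigma> r = \<sigma> b \<Longrightarrow> adj b r"
  shows two_edges_suffice
proof (rule star_suffices[OF v ab, of "{s \<in> V. side s = side b \<and> \<not> forced \<sigma> {a, b} s \<and>
              (\<exists>x y. \<sigma> x \<noteq> \<sigma> y \<and> (\<forall>z. adj s z \<longleftrightarrow> z = x \<or> z = y))}" "side b" "\<sigma> a"], blast)
  fix u assume u: "u \<in> V" "\<sigma> u \<noteq> \<sigma> a"
    and nS: "u \<notin> {s \<in> V. side s = side b \<and> \<not> forced \<sigma> {a, b} s \<and>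
              (\<exists>x y. \<sigma> x \<noteq> \<sigma> y \<and> (\<forall>z. adj s z \<longleftrightarrow> z = x \<or> z = y))}"
  have ba: "adj b a" using ab adj_sym by blast
  have da: "forced \<sigma> {a, b} a" "forced \<sigma> {a, b} b" by (auto intro: forced.base)
  have db: "forced \<sigma> {a, b} z" if "adj b z" for z
    using forced.sat[OF da(2,1) ba _ that] ab(2) by simp
  have dp: "forced \<sigma> {a, b} z" if "adj a z" for z
    using forced.sat[OF da ab that] .
  show "forced \<sigma> {a, b} u"
  proof (rule ccontr)
    assume nd: "\<not> forced \<sigma> {a, b} u"
    have side: "side u = side b"
      using opp[OF u(1)] u(2) ab(2) nd db adj_side[OF ab(1)] by blast
    have "u \<noteq> b" using nd da by blast
    then obtain q where q: "adj u q" "adj b q"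
      using common[OF u(1) adj_in[OF ba] side] by blast
    have "q \<noteq> a" using q nd dp adj_sym by blast
    then have cq: "\<sigma> q = \<sigma> b" using same_color[OF v ba q(2)] ab(2) by blast
    have other: "\<sigma> z = \<sigma> a" if z: "adj u z" "z \<noteq> q" for z
    proof (rule ccontr)
      assume "\<sigma> z \<noteq> \<sigma> a"
      then have zb: "\<sigma> z = \<sigma> b" using ab(2) by blast
      have "side z = side a" using adj_side[OF z(1)] adj_side[OF ab(1)] side by blast
      then have "adj b z" using opp zb adj_in'[OF z(1)] by blast
      then have "forced \<sigma> {a, b} u"
        using forced.two[OF db[OF q(2)] db[of z] z(2)[symmetric]] cq zb q z adj_sym by metis
      with nd show False by blast
    qed
    obtain z where z: "adj u z" "z \<noteq> q" using mindeg u(1) by blast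
    \<comment> \<open>All neighbors other than \<open>q\<close> lie across the cut from
      \<open>u\<close>, so there is only one.\<close>
    have "w = z" if "adj u w" "w \<noteq> q" for w
      using matching_coloringD[OF v z(1) that(1)] other[OF z] other[OF that] u(2) by auto
    then have "\<forall>w. adj u w \<longleftrightarrow> w = q \<or> w = z" using z q by blast
    moreover have "\<sigma> q \<noteq> \<sigma> z" using other[OF z] cq ab(2) by simp
    ultimately show False using nS u(1) side nd by blast
  qed
qed

text \<open>Common neighbors with \<open>a\<close> make every other vertex on its side adjacent to
  \<open>b\<close> or \<open>p\<close>. If \<open>covered_side_suffices\<close> fails for
  \<open>a b\<close>, it applies to \<open>r0 p\<close> with \<open>r0\<close> of color
  \<open>\<sigma> b\<close> not adjacent to \<open>b\<close>: among the neighbors of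
  \<open>b\<close> only \<open>a\<close> has color \<open>\<sigma> a\<close>, so all vertices of
  that color on the side of \<open>a\<close> are adjacent to \<open>p\<close>.\<close>

lemma deg2_cut_edge_suffices:
  assumes v: "matching_coloring \<sigma>" and ab: "adj a b" "\<sigma> a \<noteq> \<sigma> b"
    and mindeg: "\<And>u x. u \<in> V \<Longrightarrow> \<exists>z. adj u z \<and> z \<noteq> x"
    and Na: "\<And>z. adj a z \<longleftrightarrow> z = b \<or> z = p" and pb: "p \<noteq> b"
  shows two_edges_suffice
proof (cases "\<forall>r\<in>V. side r = side a \<longrightarrow> \<sigma> r = \<sigma> b \<longrightarrow> adj b r")
  case True
  then show ?thesis using covered_side_suffices[OF v ab mindeg] by blast
next
  case False
  then obtain r0 where r0: "r0 \<in> V" "side r0 = side a" "\<sigma> r0 = \<sigma> b" "\<not> adj b r0" by blast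
  have aV: "a \<in> V" using adj_in ab by blast
  have near: "adj b r \<or> adj p r" if "r \<in> V" "side r = side a" "r \<noteq> a" for r
    using common[OF aV that(1)] that Na adj_sym by metis
  have pa: "adj p a" "adj b a" using Na adj_sym by blast+
  have p: "adj r0 p" using near[of r0] r0 ab adj_sym by auto
  have cp: "\<sigma> p = \<sigma> a" using same_color[OF v ab(1)] Na pb ab(2) by blast
  have "adj p r" if "r \<in> V" "side r = side r0" "\<sigma> r = \<sigma> p" for r
    using near[of r] that r0(2) cp pa matching_coloringD[OF v pa(2), of r] ab(2) by auto
  moreover have "\<sigma> r0 \<noteq> \<sigma> p" using r0(3) cp ab(2) by simp
  ultimately show ?thesis using covered_side_suffices[OF v p _ mindeg] by blast
qed

section \<open>Vertices left open by one cut edge\<close>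

lemma forced_adj_same:
  "forced \<sigma> S u \<Longrightarrow> forced \<sigma> S w \<Longrightarrow> adj u w \<Longrightarrow> adj u v \<Longrightarrow> \<not> forced \<sigma> S v \<Longrightarrow> \<sigma> w = \<sigma> u"
  using forced.sat by blast

text \<open>A common neighbor of \<open>a\<close> and \<open>r\<close> is not \<open>b\<close>,
  whose neighbors are all forced; so it has the color of \<open>a\<close> and is forced because
  \<open>a\<close> is saturated. A second forced neighbor of this color would force
  \<open>r\<close>.\<close>

lemma free_neighbor:
  assumes v: "matching_coloring \<sigma>" and ab: "adj a b" "\<sigma> a \<noteq> \<sigma> b"
    and r: "r \<in> V" "side r = side a" "\<not> forced \<sigma> {a, b} r"
  obtains p where "adj a p" "adj p r" "forced \<sigma> {a, b} p" "\<sigma> p = \<sigma> a"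
    "\<And>z. adj z r \<Longrightarrow> forced \<sigma> {a, b} z \<Longrightarrow> \<sigma> z = \<sigma> a \<Longrightarrow> z = p"
proof -
  have ba: "adj b a" using ab adj_sym by blast
  have d: "forced \<sigma> {a, b} a" "forced \<sigma> {a, b} b" by (auto intro: forced.base)
  have "r \<noteq> a" using r d by blast
  then obtain p where p: "adj r p" "adj a p" using common r adj_in[OF ab(1)] by metis
  have pr: "adj p r" using p adj_sym by blast
  have "p \<noteq> b" using forced.sat[OF d(2,1) ba _, of r] ab(2) r(3) pr by auto
  then have cp: "\<sigma> p = \<sigma> a" using same_color[OF v ab(1) p(2)] ab(2) by auto
  have dp: "forced \<sigma> {a, b} p" by (rule forced.sat[OF d ab p(2)])
  have "z = p" if "adj z r" "forced \<sigma> {a, b} z" "\<sigma> z = \<sigma> a" for z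
    using forced.two[OF that(2) dp _ _ that(1) pr] that(3) cp r(3) by auto
  then show thesis using that p(2) pr dp cp by blast
qed

text \<open>This provides a hub \<open>p\<close>: a cut edge at \<open>p\<close> would force
  everything on the side of \<open>a\<close> that \<open>{a, b, r, s}\<close> leaves open. The last
  conclusion allows passing from an open vertex to an open one of the same color on the other
  side.\<close>

lemma free_cut_edge:
  assumes v: "matching_coloring \<sigma>" and ab: "adj a b" "\<sigma> a \<noteq> \<sigma> b"
    and deg: "\<forall>u w x y. adj u w \<longrightarrow> \<sigma> u \<noteq> \<sigma> w \<longrightarrow> (\<exists>z. adj u z \<and> z \<noteq> x \<and> z \<noteq> y)"
    and rs: "adj r s" "\<sigma> r = \<sigma> a" "\<sigma> s = \<sigma> b" "side r = side a" "side s = side b"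
    and free: "\<not> forced \<sigma> {a, b} r" "\<not> forced \<sigma> {a, b} s"
  obtains p where "adj p a" "adj p r" "\<sigma> p = \<sigma> a"
    "\<And>u. u \<in> V \<Longrightarrow> side u = side a \<Longrightarrow> \<not> forced \<sigma> {a, b, r, s} u \<Longrightarrow>
       adj p u \<and> (\<exists>z. adj u z \<and> \<not> forced \<sigma> {a, b, r, s} z \<and> \<sigma> z = \<sigma> u)"
proof -
  have deg3: "\<exists>z. adj u z \<and> z \<noteq> x \<and> z \<noteq> y" if "adj u w" "\<sigma> u \<noteq> \<sigma> w" for u w x y
    using deg that by blast
  have ba: "adj b a" "\<sigma> b \<noteq> \<sigma> a" and sr: "adj s r" using ab rs adj_sym by auto
  have rV: "r \<in> V" and sV: "s \<in> V" using rs adj_in adj_in' by blast+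
  have comm: "{b, a} = {a, b}" by blast
  have s0: "\<not> forced \<sigma> {b, a} s" using free by (simp add: comm)
  obtain p where p: "adj a p" "adj p r" "forced \<sigma> {a, b} p" "\<sigma> p = \<sigma> a"
    "\<And>z. adj z r \<Longrightarrow> forced \<sigma> {a, b} z \<Longrightarrow> \<sigma> z = \<sigma> a \<Longrightarrow> z = p"
    using free_neighbor[OF v ab rV rs(4) free(1)] by blast
  obtain q where q: "adj b q" "adj q s" "forced \<sigma> {a, b} q" "\<sigma> q = \<sigma> b"
    "\<And>z. adj z s \<Longrightarrow> forced \<sigma> {a, b} z \<Longrightarrow> \<sigma> z = \<sigma> b \<Longrightarrow> z = q"
    using free_neighbor[OF v ba sV rs(5) s0, unfolded comm] by blast
  let ?D = "forced \<sigma> {a, b, r, s}"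
  have D0: "?D u" if "forced \<sigma> {a, b} u" for u by (rule forced_subset[OF that]) simp
  have d: "?D a" "?D b" "?D r" "?D s" by (auto intro: forced.base)
  have rsn: "\<sigma> r \<noteq> \<sigma> s" using rs ab by simp
  have Ds: "?D u" "u \<noteq> r \<Longrightarrow> \<sigma> u = \<sigma> b" if "adj s u" for u
    using forced.sat[OF d(4,3) sr rsn[symmetric] that] same_color[OF v sr that] rsn rs by auto
  have Dr: "?D u" "u \<noteq> s \<Longrightarrow> \<sigma> u = \<sigma> a" if "adj r u" for u
    using forced.sat[OF d(3,4) rs(1) rsn that] same_color[OF v rs(1) that] rsn rs by auto
  have one: "adj p u" if u: "u \<in> V" "side u = side a" "\<not> ?D u" for u
  proof -
    obtain p' where p': "adj a p'" "adj p' u" "forced \<sigma> {a, b} p'" "\<sigma> p' = \<sigma> a"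
      using free_neighbor[OF v ab u(1,2)] D0 u(3) by blast
    \<comment> \<open>A common neighbor \<open>r2\<close> of \<open>p'\<close> and \<open>s\<close>
      differs from \<open>r\<close>, because \<open>p\<close> is the only neighbor of
      \<open>r\<close> forced by \<open>{a, b}\<close> with color \<open>\<sigma> a\<close>. So
      \<open>r2\<close> has the color of \<open>s\<close>, and the edge \<open>p' r2\<close>
      saturates \<open>p'\<close> and forces \<open>u\<close>.\<close>
    have "p' = p"
    proof (rule ccontr)
      assume ne: "p' \<noteq> p"
      have "side p' = side s" "p' \<noteq> s"
        using adj_side[OF p'(1)] adj_side[OF ab(1)] rs p' ab by auto
      then obtain r2 where r2: "adj p' r2" "adj s r2"
        using common[OF adj_in[OF p'(2)] sV] by blast
      have "r2 \<noteq> r" using p(5)[of p'] p' r2 ne by blast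
      then have "\<sigma> p' \<noteq> \<sigma> r2" using Ds(2)[OF r2(2)] p'(4) ab by simp
      then have "?D u" using forced.sat[OF D0[OF p'(3)] Ds(1)[OF r2(2)] r2(1) _ p'(2)] by blast
      then show False using u by blast
    qed
    then show ?thesis using p' by simp
  qed
  have two: "\<exists>z. adj u z \<and> \<not> ?D z \<and> \<sigma> z = \<sigma> u" if u: "u \<in> V" "side u = side a" "\<not> ?D u" for u
  proof -
    have pu: "adj p u" "adj u p" using one[OF u] adj_sym by blast+
    \<comment> \<open>The degree assumption enters here. A common neighbor of this third vertex
      \<open>q'\<close> and \<open>r\<close> is not \<open>s\<close>, so it has color
      \<open>\<sigma> a\<close> and saturates \<open>q'\<close>.\<close>
    obtain q' where q': "adj b q'" "q' \<noteq> a" "q' \<noteq> q" using deg3[OF ba] by blast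
    have cq': "\<sigma> q' = \<sigma> b" using same_color[OF v ba(1) q'(1)] ab q' by auto
    have dq': "forced \<sigma> {a, b} q'"
      by (rule forced.sat[of _ _ b a]) (use ba q' in \<open>auto intro: forced.base\<close>)
    have sq': "side q' = side a" "q' \<in> V"
      using adj_side[OF q'(1)] adj_side[OF ab(1)] adj_in'[OF q'(1)] by auto
    have "q' \<noteq> r" "q' \<noteq> u" using dq' free u D0 by blast+
    then obtain s2 where s2: "adj q' s2" "adj r s2" using common[OF sq'(2) rV] sq' rs by auto
    have "s2 \<noteq> s" using q(5)[OF _ dq' cq'] s2 q'(3) by blast
    then have c2: "\<sigma> q' \<noteq> \<sigma> s2" using Dr(2)[OF s2(2)] cq' ab by simp
    have Dq': "?D z" if "adj q' z" for z
      by (rule forced.sat[OF D0[OF dq'] Dr(1)[OF s2(2)] s2(1) c2 that])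
    obtain t where t: "adj q' t" "adj u t" using common[OF sq'(2) u(1)] sq' u \<open>q' \<noteq> u\<close> by auto
    have tq: "adj t q'" "adj t u" using t adj_sym by blast+
    have ct: "\<sigma> t = \<sigma> b"
      using forced_adj_same[OF Dq'[OF t(1)] D0[OF dq'] tq u(3)] cq' by simp
    \<comment> \<open>The forced neighbors \<open>p\<close> and \<open>t\<close> of \<open>u\<close>
      differ in color, so \<open>u\<close> has a cut edge and thus a third neighbor
      \<open>z\<close>. A forced \<open>z\<close> would agree with \<open>p\<close> or
      \<open>t\<close> and force \<open>u\<close>.\<close>
    have "\<exists>w. adj u w \<and> \<sigma> u \<noteq> \<sigma> w" using pu t ct p(4) ab(2) by metis
    then obtain z where z: "adj u z" "z \<noteq> p" "z \<noteq> t" using deg3 by blast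
    have zu: "adj z u" using z adj_sym by blast
    have nz: "\<not> ?D z"
    proof
      assume dz: "?D z"
      consider "\<sigma> z = \<sigma> p" | "\<sigma> z = \<sigma> t" using ct p(4) ab(2) by auto
      then have "?D u"
        using forced.two[OF dz D0[OF p(3)] z(2) _ zu pu(1)]
          forced.two[OF dz Dq'[OF t(1)] z(3) _ zu tq(2)] by cases
      then show False using u by blast
    qed
    have "\<sigma> z = \<sigma> u"
    proof (cases "\<sigma> u = \<sigma> p")
      case True
      then show ?thesis using same_color[OF v t(2) z(1)] z ct p(4) ab(2) by auto
    next
      case False
      then show ?thesis using same_color[OF v pu(2) z(1)] z by auto
    qed
    then show ?thesis using z(1) nz by blast
  qed
  show thesis using that[of p] p one two adj_sym by blast
qed

text \<open>The natural second edge is \<open>r s\<close>. If \<open>a b\<close> and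
  \<open>r s\<close> leave open vertices of both colors, these supply cut edges at the hubs of both
  sides, and this new pair replaces the old one.\<close>

lemma free_cut_edge_suffices:
  assumes v: "matching_coloring \<sigma>" and ab: "adj a b" "\<sigma> a \<noteq> \<sigma> b"
    and deg: "\<forall>u w x y. adj u w \<longrightarrow> \<sigma> u \<noteq> \<sigma> w \<longrightarrow> (\<exists>z. adj u z \<and> z \<noteq> x \<and> z \<noteq> y)"
    and rs: "adj r s" "\<sigma> r = \<sigma> a" "\<sigma> s = \<sigma> b" "side r = side a" "side s = side b"
    and free: "\<not> forced \<sigma> {a, b} r" "\<not> forced \<sigma> {a, b} s"
  shows two_edges_suffice
proof -
  have ba: "adj b a" "\<sigma> b \<noteq> \<sigma> a" and sr: "adj s r" using ab rs adj_sym by auto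
  let ?D = "forced \<sigma> {a, b, r, s}"
  have comm: "{b, a, s, r} = {a, b, r, s}" "{b, a} = {a, b}" by blast+
  obtain p where p: "adj p a" "adj p r" "\<sigma> p = \<sigma> a"
    "\<And>u. u \<in> V \<Longrightarrow> side u = side a \<Longrightarrow> \<not> ?D u \<Longrightarrow>
       adj p u \<and> (\<exists>z. adj u z \<and> \<not> ?D z \<and> \<sigma> z = \<sigma> u)"
    using free_cut_edge[OF v ab deg rs free] by blast
  obtain q where q: "adj q b" "adj q s" "\<sigma> q = \<sigma> b"
    "\<And>u. u \<in> V \<Longrightarrow> side u = side b \<Longrightarrow> \<not> ?D u \<Longrightarrow>
       adj q u \<and> (\<exists>z. adj u z \<and> \<not> ?D z \<and> \<sigma> z = \<sigma> u)"
    using free_cut_edge[OF v ba deg sr rs(3,2,5,4), unfolded comm, OF free(2,1)] by blast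
  have sd: "side u = side a \<or> side u = side b" for u using adj_side[OF ab(1)] by blast
  have rsn: "\<sigma> r \<noteq> \<sigma> s" using rs ab by simp
  show ?thesis
  proof (cases "\<exists>d. \<forall>u\<in>V. \<not> ?D u \<longrightarrow> \<sigma> u = d")
    case True
    then show ?thesis using suffice_twoI[OF v ab rs(1) rsn] by blast
  next
    case False
    obtain y where y: "y \<in> V" "\<not> ?D y" "\<sigma> y \<noteq> \<sigma> a" using False by blast
    obtain x where x: "x \<in> V" "\<not> ?D x" "\<sigma> x \<noteq> \<sigma> b" using False by blast
    \<comment> \<open>If \<open>y\<close> is on the wrong side, its open neighbor of the same color
      is on the right one.\<close>
    have "\<exists>y\<in>V. \<not> ?D y \<and> \<sigma> y = \<sigma> b \<and> side y = side a"
    proof (cases "side y = side a")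
      case True then show ?thesis using y ab by blast
    next
      case False
      then obtain z where z: "adj y z" "\<not> ?D z" "\<sigma> z = \<sigma> y" using q(4) y sd by blast
      then show ?thesis
        using adj_side[OF z(1)] adj_in'[OF z(1)] y ab(2) False by blast
    qed
    then obtain ry where ry: "ry \<in> V" "\<not> ?D ry" "\<sigma> ry = \<sigma> b" "side ry = side a" by blast
    have "\<exists>y\<in>V. \<not> ?D y \<and> \<sigma> y = \<sigma> a \<and> side y = side b"
    proof (cases "side x = side b")
      case True then show ?thesis using x ab by blast
    next
      case False
      then obtain z where z: "adj x z" "\<not> ?D z" "\<sigma> z = \<sigma> x" using p(4) x sd by blast
      then show ?thesis
        using adj_side[OF z(1)] adj_in'[OF z(1)] x ab(2) False by blast
    qed
    then obtain sx where sx: "sx \<in> V" "\<not> ?D sx" "\<sigma> sx = \<sigma> a" "side sx = side b" by blast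
    \<comment> \<open>The cut edges \<open>p ry\<close> and \<open>q sx\<close> force \<open>a\<close>, \<open>b\<close>, \<open>r\<close>, \<open>s\<close> and all vertices not forced by these.\<close>
    have py: "adj p ry" "\<sigma> p \<noteq> \<sigma> ry" using p(4) ry p(3) ab by auto
    have qx: "adj q sx" "\<sigma> q \<noteq> \<sigma> sx" using q(4) sx q(3) ab by auto
    let ?E = "forced \<sigma> {p, ry, q, sx}"
    have e: "?E p" "?E ry" "?E q" "?E sx" by (auto intro: forced.base)
    have Ep: "?E u" if "adj p u" for u by (rule forced.sat[OF e(1,2) py that])
    have Eq: "?E u" if "adj q u" for u by (rule forced.sat[OF e(3,4) qx that])
    have DE: "?E u" if "?D u" for u
      using that by (rule forced_mono) (use p q Ep Eq in blast)
    have "?E u" if "u \<in> V" for u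
      using DE p(4)[OF that] q(4)[OF that] Ep Eq sd by blast
    then show ?thesis using suffice_twoI[OF v py qx] by blast
  qed
qed

text \<open>Every cut edge now has a forced end, so the second edge is sought between a forced and
  an open vertex. With default color \<open>\<sigma> b\<close> it has to reach only the open
  vertices of color \<open>\<sigma> a\<close> on the side of \<open>a\<close>; those on the other
  side follow by their degree.\<close>

lemma no_free_cut_edge_suffices:
  assumes v: "matching_coloring \<sigma>" and ab: "adj a b" "\<sigma> a \<noteq> \<sigma> b"
    and mindeg: "\<And>u x. u \<in> V \<Longrightarrow> \<exists>z. adj u z \<and> z \<noteq> x"
    and deg: "\<forall>u w x y. adj u w \<longrightarrow> \<sigma> u \<noteq> \<sigma> w \<longrightarrow> (\<exists>z. adj u z \<and> z \<noteq> x \<and> z \<noteq> y)"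
    and mono: "\<And>r s. adj r s \<Longrightarrow> \<not> forced \<sigma> {a, b} r \<Longrightarrow> \<not> forced \<sigma> {a, b} s \<Longrightarrow> \<sigma> r = \<sigma> s"
  shows two_edges_suffice
proof (cases "\<exists>d. \<forall>u\<in>V. \<not> forced \<sigma> {a, b} u \<longrightarrow> \<sigma> u = d")
  case True
  then show ?thesis using suffice_oneI[OF v ab] by blast
next
  case False
  have deg3: "\<exists>z. adj u z \<and> z \<noteq> x \<and> z \<noteq> y" if "adj u w" "\<sigma> u \<noteq> \<sigma> w" for u w x y
    using deg that by blast
  let ?D = "forced \<sigma> {a, b}"
  have ba: "adj b a" "\<sigma> b \<noteq> \<sigma> a" using ab adj_sym by auto
  have sd: "side u = side a \<or> side u = side b" for u using adj_side[OF ab(1)] by blast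
  have bin: "\<sigma> u = \<sigma> a \<or> \<sigma> u = \<sigma> b" for u using ab(2) by blast
  have comm: "{b, a} = {a, b}" by blast
  \<comment> \<open>Otherwise the neighbors of \<open>u\<close> have pairwise different colors; but
    two of different colors yield a cut edge at \<open>u\<close> and hence a third neighbor.\<close>
  have fn: "\<exists>z. adj u z \<and> \<not> ?D z" if u: "u \<in> V" "\<not> ?D u" for u
  proof (rule ccontr)
    assume "\<nexists>z. adj u z \<and> \<not> ?D z"
    then have D: "?D z" if "adj u z" for z using that by blast
    have two: "\<sigma> z \<noteq> \<sigma> z'" if "adj u z" "adj u z'" "z \<noteq> z'" for z z'
      using forced.two[OF D[OF that(1)] D[OF that(2)] that(3)] that adj_sym u by blast
    obtain z where z: "adj u z" using mindeg u by blast
    obtain z' where z': "adj u z'" "z' \<noteq> z" using mindeg u by blast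
    have "\<exists>w. adj u w \<and> \<sigma> u \<noteq> \<sigma> w" using two[OF z z'(1)] z z' by metis
    then obtain z'' where "adj u z''" "z'' \<noteq> z" "z'' \<noteq> z'" using deg3 by blast
    then show False using two[of z z'] two[of z z''] two[of z' z''] z z' by blast
  qed
  have side_a: "\<exists>r\<in>V. side r = side a \<and> \<not> ?D r \<and> \<sigma> r = \<sigma> u" if u: "u \<in> V" "\<not> ?D u" for u
  proof (cases "side u = side a")
    case True then show ?thesis using u by blast
  next
    case False
    obtain z where z: "adj u z" "\<not> ?D z" using fn[OF u] by blast
    then show ?thesis using mono[OF z(1) u(2) z(2)] adj_side[OF z(1)] adj_in'[OF z(1)] False by blast
  qed
  \<comment> \<open>A vertex \<open>u\<close> of color \<open>\<sigma> a\<close> on the side of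
    \<open>b\<close>, if open, has its cut edge to a neighbor \<open>q\<close> of \<open>b\<close>.
    At least two more neighbors exist; they have color \<open>\<sigma> a\<close>, are forced by
    \<open>all\<close> or already before, and force \<open>u\<close>.\<close>
  have finish: two_edges_suffice if e: "adj x y" "\<sigma> x \<noteq> \<sigma> y"
    and all: "\<And>r. r \<in> V \<Longrightarrow> side r = side a \<Longrightarrow> \<not> ?D r \<Longrightarrow> \<sigma> r = \<sigma> a \<Longrightarrow> forced \<sigma> {a, b, x, y} r" for x y
  proof (rule suffice_twoI[OF v ab e, of "\<sigma> b"])
    let ?E = "forced \<sigma> {a, b, x, y}"
    have DE: "?E u" if "?D u" for u by (rule forced_subset[OF that]) simp
    fix u assume u: "u \<in> V" "\<sigma> u \<noteq> \<sigma> b"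
    then have cu: "\<sigma> u = \<sigma> a" using bin by blast
    show "?E u"
    proof (rule ccontr)
      assume nE: "\<not> ?E u"
      then have nD: "\<not> ?D u" using DE by blast
      then have sb: "side u = side b" using all u cu nE sd by blast
      obtain q where q: "adj b q" "adj q u" "?D q" "\<sigma> q = \<sigma> b"
        using free_neighbor[OF v ba u(1) sb, unfolded comm, OF nD] by blast
      have uq: "adj u q" "\<sigma> u \<noteq> \<sigma> q" using q u adj_sym by auto
      have oth: "?E z" "\<sigma> z = \<sigma> a" if "adj u z" "z \<noteq> q" for z
      proof -
        show c: "\<sigma> z = \<sigma> a" using same_color[OF v uq(1) that(1)] uq that cu by auto
        show "?E z" using all[OF adj_in'[OF that(1)] _ _ c] DE adj_side[OF that(1)] sb
            adj_side[OF ab(1)] by blast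
      qed
      obtain z where z: "adj u z" "z \<noteq> q" using deg3[OF uq] by blast
      obtain z' where z': "adj u z'" "z' \<noteq> q" "z' \<noteq> z" using deg3[OF uq] by blast
      have "?E u"
        using forced.two[OF oth(1)[OF z'(1,2)] oth(1)[OF z] z'(3)] oth z z' adj_sym by metis
      then show False using nE by blast
    qed
  qed
  have "\<exists>u\<in>V. \<not> ?D u \<and> \<sigma> u = \<sigma> b" using False bin by blast
  then obtain r' where r': "r' \<in> V" "side r' = side a" "\<not> ?D r'" "\<sigma> r' = \<sigma> b"
    using side_a by metis
  obtain p where p: "adj a p" "adj p r'" "?D p" "\<sigma> p = \<sigma> a"
    "\<And>z. adj z r' \<Longrightarrow> ?D z \<Longrightarrow> \<sigma> z = \<sigma> a \<Longrightarrow> z = p"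
    using free_neighbor[OF v ab r'(1-3)] by blast
  have pr: "\<sigma> p \<noteq> \<sigma> r'" using p(4) r'(4) ab by simp
  \<comment> \<open>By \<open>mono\<close>, an open common neighbor of \<open>r\<close> and
    \<open>r'\<close> would have the colors of both, which differ. A forced one of color
    \<open>\<sigma> a\<close> can only be \<open>p\<close>.\<close>
  have share: "adj p r \<or> (\<exists>t. adj r t \<and> adj r' t \<and> ?D t \<and> \<sigma> t = \<sigma> b)"
    if r: "r \<in> V" "side r = side a" "\<not> ?D r" "\<sigma> r = \<sigma> a" for r
  proof -
    have "r \<noteq> r'" using r r' ab by auto
    then obtain z where z: "adj r z" "adj r' z" using common r r' by metis
    have "?D z" using mono[OF z(1) r(3)] mono[OF z(2) r'(3)] r r' ab by metis
    then show ?thesis using p(5)[of z] z bin[of z] adj_sym by metis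
  qed
  show ?thesis
  proof (cases "\<exists>r t. r \<in> V \<and> side r = side a \<and> \<not> ?D r \<and> \<sigma> r = \<sigma> a \<and>
      adj r t \<and> adj r' t \<and> ?D t \<and> \<sigma> t = \<sigma> b")
    case True
    then obtain r t where r: "r \<in> V" "side r = side a" "\<not> ?D r" "\<sigma> r = \<sigma> a"
      and t: "adj r t" "adj r' t" "?D t" "\<sigma> t = \<sigma> b" by blast
    have tr: "adj t r" "adj t r'" using t adj_sym by blast+
    have rt: "\<sigma> r \<noteq> \<sigma> t" using r t ab by simp
    show ?thesis
    proof (rule finish[OF t(1) rt])
      let ?E = "forced \<sigma> {a, b, r, t}"
      have e: "?E r" "?E t" by (auto intro: forced.base)
      have Er': "?E r'" by (rule forced.sat[OF e(2,1) tr(1) rt[symmetric] tr(2)])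
      have Ep: "?E p" by (rule forced_subset[OF p(3)]) simp
      fix r2 assume r2: "r2 \<in> V" "side r2 = side a" "\<not> ?D r2" "\<sigma> r2 = \<sigma> a"
      from share[OF this] show "?E r2"
      proof
        assume "adj p r2"
        then show ?thesis by (rule forced.sat[OF Ep Er' p(2) pr])
      next
        assume "\<exists>t. adj r2 t \<and> adj r' t \<and> ?D t \<and> \<sigma> t = \<sigma> b"
        then obtain t' where t': "adj r2 t'" "adj r' t'" "?D t'" "\<sigma> t' = \<sigma> b" by blast
        \<comment> \<open>Otherwise \<open>t\<close> and \<open>t'\<close> would force
          \<open>r'\<close>. As \<open>t\<close> has only one cut edge, \<open>r2\<close> is then
          \<open>r\<close>.\<close>
        have "t' = t"
          using forced.two[OF t'(3) t(3), of r'] t' t adj_sym r'(3) by metis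
        then have "r2 = r" using matching_coloringD[OF v tr(1), of r2] t' r2 t(4) rt adj_sym ab(2) by metis
        then show ?thesis using e by simp
      qed
    qed
  next
    case none: False
    show ?thesis
    proof (rule finish[OF p(2) pr])
      fix r assume r: "r \<in> V" "side r = side a" "\<not> ?D r" "\<sigma> r = \<sigma> a"
      then have "adj p r" using share none by blast
      then show "forced \<sigma> {a, b, p, r'} r"
        by (rule forced.sat[OF _ _ p(2) pr, rotated 2]) (auto intro: forced.base)
    qed
  qed
qed

text \<open>In a counterexample no vertex has degree 1 and no end of a cut edge has degree 2, which
  leaves the two lemmas on open cut edges. The given cut need not be the one that witnesses the
  conclusion.\<close>

theorem matching_cut_suffices:
  assumes v: "matching_coloring \<sigma>" and ab: "adj a b" "\<sigma> a \<noteq> \<sigma> b"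
    and iso: "\<And>u. u \<in> V \<Longrightarrow> \<exists>z. adj u z"
  shows two_edges_suffice
proof (rule ccontr)
  assume ng: "\<not> two_edges_suffice"
  have mindeg: "\<exists>z. adj u z \<and> z \<noteq> x" if "u \<in> V" for u x
    using pendant_suffices iso[OF that] ng by metis
  have deg: "\<forall>u w x y. adj u w \<longrightarrow> \<sigma> u \<noteq> \<sigma> w \<longrightarrow> (\<exists>z. adj u z \<and> z \<noteq> x \<and> z \<noteq> y)"
  proof (intro allI impI, rule ccontr)
    fix u w x y
    assume uw: "adj u w" "\<sigma> u \<noteq> \<sigma> w"
    assume no: "\<nexists>z. adj u z \<and> z \<noteq> x \<and> z \<noteq> y"
    obtain p where p: "adj u p" "p \<noteq> w" using mindeg adj_in[OF uw(1)] by blast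
    have "adj u z \<longleftrightarrow> z = w \<or> z = p" for z using no uw p by metis
    from deg2_cut_edge_suffices[OF v uw mindeg this p(2)] ng show False by blast
  qed
  have "\<sigma> r = \<sigma> s" if rs: "adj r s" "\<not> forced \<sigma> {a, b} r" "\<not> forced \<sigma> {a, b} s" "side r = side a" for r s
  proof (rule ccontr)
    assume ne: "\<sigma> r \<noteq> \<sigma> s"
    obtain p where p: "adj a p" "adj p r" "forced \<sigma> {a, b} p" "\<sigma> p = \<sigma> a"
      using free_neighbor[OF v ab adj_in[OF rs(1)] rs(4,2)] by blast
    \<comment> \<open>The cut edge of \<open>r\<close> goes to \<open>s\<close>, so \<open>r\<close>
      has the color of \<open>p\<close>, that is of \<open>a\<close>. Thus \<open>r s\<close> is
      colored like \<open>a b\<close>.\<close>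
    have "p \<noteq> s" using p rs by blast
    then have "\<sigma> r = \<sigma> a" using same_color[OF v rs(1) adj_sym[OF p(2)]] ne p by simp
    moreover from this have "\<sigma> s = \<sigma> b" using ne ab by blast
    moreover have "side s = side b" using adj_side[OF rs(1)] adj_side[OF ab(1)] rs(4) by blast
    ultimately show False using free_cut_edge_suffices[OF v ab deg rs(1) _ _ rs(4) _ rs(2,3)] ng by blast
  qed
  then have "\<sigma> r = \<sigma> s" if "adj r s" "\<not> forced \<sigma> {a, b} r" "\<not> forced \<sigma> {a, b} s" for r s
    using that adj_sym adj_side adj_side[OF that(1)] by metis
  then show False using no_free_cut_edge_suffices[OF v ab mindeg deg] ng by blast
qed

end

section \<open>Programs\<close>

text \<open>Registers below \<open>d\<close> are preserved, so that loop counters are safe from the loop body.\<close>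

definition does :: "prog \<Rightarrow> nat \<Rightarrow> state \<Rightarrow> ((nat \<Rightarrow> nat) \<Rightarrow> bool) \<Rightarrow> nat \<Rightarrow> bool" where
  "does c d s P T \<longleftrightarrow>
     (\<exists>t s'. exec c s t s' \<and> t \<le> T \<and> (\<forall>k<d. fst s' k = fst s k) \<and> P (snd s'))"

definition for_loop :: "nat \<Rightarrow> nat \<Rightarrow> prog \<Rightarrow> prog" where
  "for_loop r b c = Seq (SetReg r (Const 0))
     (While (Less (Reg r) (Reg b)) (Seq c (SetReg r (Plus (Reg r) (Const 1)))))"

lemma does_mono:
  "does c d s P T \<Longrightarrow> (\<And>M. P M \<Longrightarrow> Q M) \<Longrightarrow> T \<le> T' \<Longrightarrow> d' \<le> d \<Longrightarrow> does c d' s Q T'"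
  unfolding does_def by (meson le_trans less_le_trans)

lemma exec_SetRegI:
  "R' = R(r := expr_val a (R, M)) \<Longrightarrow> t = expr_cost a + 1 \<Longrightarrow> exec (SetReg r a) (R, M) t (R', M)"
  using exec.SetReg[of r a "(R, M)"] by simp

lemma does_Skip: "P M \<Longrightarrow> 1 \<le> T \<Longrightarrow> does Skip d (R, M) P T"
  unfolding does_def using exec.Skip[of "(R, M)"] by auto

lemma does_SetMem:
  "P (M(expr_val a (R, M) := expr_val b (R, M))) \<Longrightarrow> expr_cost a + expr_cost b + 1 \<le> T \<Longrightarrow>
   does (SetMem a b) d (R, M) P T"
  unfolding does_def using exec.SetMem[of a b "(R, M)"] by fastforce

lemma does_Seq:
  assumes "does c d (R, M) P T1"
    and "\<And>R' M'. (\<And>k. k < d \<Longrightarrow> R' k = R k) \<Longrightarrow> P M' \<Longrightarrow> does c' d (R', M') Q T2"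
    and "T1 + T2 \<le> T"
  shows "does (Seq c c') d (R, M) Q T"
proof -
  obtain t R' M' where 1: "exec c (R, M) t (R', M')" "t \<le> T1" "\<And>k. k < d \<Longrightarrow> R' k = R k" "P M'"
    using assms(1) unfolding does_def by auto
  obtain t' s'' where 2: "exec c' (R', M') t' s''" "t' \<le> T2" "\<forall>k<d. fst s'' k = R' k" "Q (snd s'')"
    using assms(2)[of R' M'] 1(3,4) unfolding does_def by auto
  have "exec (Seq c c') (R, M) (t + t') s''" using 1 2 exec.Seq by blast
  moreover have "t + t' \<le> T" using 1(2) 2(2) assms(3) by linarith
  ultimately show ?thesis
    unfolding does_def using 1(3) 2(3,4) by (intro exI[of _ "t + t'"] exI[of _ s'']) auto
qed

lemma does_If:
  assumes "test_val b s \<Longrightarrow> does c d s P T'" and "\<not> test_val b s \<Longrightarrow> does c' d s P T'"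
    and "test_cost b + T' \<le> T"
  shows "does (If b c c') d s P T"
proof (cases "test_val b s")
  case True
  from assms(1)[OF True] obtain t s' where
    "exec c s t s'" "t \<le> T'" "\<forall>k<d. fst s' k = fst s k" "P (snd s')"
    unfolding does_def by blast
  with exec.IfTrue[of b s c t s' c'] True assms(3) show ?thesis
    unfolding does_def by (intro exI[of _ "test_cost b + t"] exI[of _ s']) auto
next
  case False
  from assms(2)[OF False] obtain t s' where
    "exec c' s t s'" "t \<le> T'" "\<forall>k<d. fst s' k = fst s k" "P (snd s')"
    unfolding does_def by blast
  with exec.IfFalse[of b s c' t s' c] False assms(3) show ?thesis
    unfolding does_def by (intro exI[of _ "test_cost b + t"] exI[of _ s']) auto
qed

text \<open>The bound is read from a register below the counter, hence is constant during the loop.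
  The 5 steps are the initialization (2) and the last test (3), the 7 steps a test (3) and the
  increment (4).\<close>

lemma does_for:
  assumes b: "b < r" "R b = N"
    and I0: "I 0 M"
    and body: "\<And>i R' M'. i < N \<Longrightarrow> (\<And>k. k < r \<Longrightarrow> R' k = R k) \<Longrightarrow> R' r = i \<Longrightarrow> I i M' \<Longrightarrow>
        does c (Suc r) (R', M') (I (Suc i)) T"
  shows "does (for_loop r b c) r (R, M) (I N) (5 + N * (T + 7))"
proof -
  let ?W = "While (Less (Reg r) (Reg b)) (Seq c (SetReg r (Plus (Reg r) (Const 1))))"
  have loop: "\<exists>t s'. exec ?W (R', M') t s' \<and> t \<le> 3 + (N - i) * (T + 7) \<and>
      (\<forall>k<r. fst s' k = R k) \<and> I N (snd s')"
    if "i \<le> N" "\<forall>k<r. R' k = R k" "R' r = i" "I i M'" for i R' M'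
    using that
  proof (induction "N - i" arbitrary: i R' M')
    case 0
    then have "i = N" by simp
    with 0 b have "exec ?W (R', M') 3 (R', M')"
      using exec.WhileFalse[of "Less (Reg r) (Reg b)" "(R', M')"] by (simp add: eval_nat_numeral)
    with 0 \<open>i = N\<close> show ?case by (intro exI[of _ 3] exI[of _ "(R', M')"]) auto
  next
    case (Suc x)
    then have iN: "i < N" by simp
    from body[of i R' M'] iN Suc.prems(2-4) obtain t1 R1 M1 where
      1: "exec c (R', M') t1 (R1, M1)" "t1 \<le> T" "\<forall>k<Suc r. R1 k = R' k" "I (Suc i) M1"
      unfolding does_def by auto
    have r1: "R1 r = i" using 1(3) Suc.prems(3) by simp
    have "exec (SetReg r (Plus (Reg r) (Const 1))) (R1, M1) 4 (R1(r := Suc i), M1)"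
      using exec.SetReg[of r "Plus (Reg r) (Const 1)" "(R1, M1)"] r1 by (simp add: eval_nat_numeral)
    then have 2: "exec (Seq c (SetReg r (Plus (Reg r) (Const 1)))) (R', M') (t1 + 4)
        (R1(r := Suc i), M1)"
      by (rule exec.Seq[OF 1(1)])
    have x: "x = N - Suc i" using Suc.hyps(2) by simp
    have ag: "\<forall>k<r. (R1(r := Suc i)) k = R k" using 1(3) Suc.prems(2) by auto
    have "\<exists>t s'. exec ?W (R1(r := Suc i), M1) t s' \<and> t \<le> 3 + (N - Suc i) * (T + 7) \<and>
        (\<forall>k<r. fst s' k = R k) \<and> I N (snd s')"
      by (rule Suc.hyps(1)[OF x _ ag _ 1(4)]) (use iN in simp_all)
    then obtain t2 s' where
      3: "exec ?W (R1(r := Suc i), M1) t2 s'" "t2 \<le> 3 + (N - Suc i) * (T + 7)"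
        "\<forall>k<r. fst s' k = R k" "I N (snd s')"
      by blast
    have tv: "test_val (Less (Reg r) (Reg b)) (R', M')" using Suc.prems b iN by simp
    have "exec ?W (R', M') (test_cost (Less (Reg r) (Reg b)) + (t1 + 4) + t2) s'"
      by (rule exec.WhileTrue[OF tv 2 3(1)])
    moreover have "N - i = Suc (N - Suc i)" using iN by simp
    then have "test_cost (Less (Reg r) (Reg b)) + (t1 + 4) + t2 \<le> 3 + (N - i) * (T + 7)"
      using 1(2) 3(2) by simp
    ultimately show ?case using 3 by blast
  qed
  have "exec (SetReg r (Const 0)) (R, M) 2 (R(r := 0), M)"
    using exec.SetReg[of r "Const 0" "(R, M)"] by (simp add: eval_nat_numeral)
  moreover obtain t s' where w: "exec ?W (R(r := 0), M) t s'" "t \<le> 3 + N * (T + 7)"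
      "\<forall>k<r. fst s' k = R k" "I N (snd s')"
    using loop[of 0 "R(r := 0)" M] I0 by auto
  ultimately have "exec (for_loop r b c) (R, M) (2 + t) s'"
    unfolding for_loop_def using exec.Seq by blast
  then show ?thesis unfolding does_def using w by (intro exI[of _ "2 + t"] exI[of _ s']) auto
qed

text \<open>Registers 0 to 5 hold \<open>n\<close>, \<open>m\<close>, \<open>2 * m\<close>, the bases of the color and counter arrays, and
  \<open>3 * n\<close>; registers 6 to 9 are loop counters. The colors of the two sides of a cut are \<open>n\<close> and
  \<open>2 * n\<close>, so that \<open>3 * n - c\<close> is the color opposite to \<open>c\<close> and counter \<open>c + v\<close> holds the number
  of neighbors of \<open>v\<close> with color \<open>c\<close>. Color 0 means undecided.\<close>

definition fst_end :: "nat \<Rightarrow> expr" where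
  "fst_end r = Mem (Plus (Reg r) (Reg r))"

definition snd_end :: "nat \<Rightarrow> expr" where
  "snd_end r = Mem (Plus (Plus (Reg r) (Reg r)) (Const 1))"

definition col_at :: "expr \<Rightarrow> expr" where
  "col_at x = Plus (Reg 3) x"

definition cnt_at :: "expr \<Rightarrow> expr" where
  "cnt_at x = Plus (Reg 4) x"

text \<open>For an undecided vertex this address lies behind the \<open>3 * n\<close> counters in
  use, where the memory stays 0.\<close>

definition opp_at :: "expr \<Rightarrow> expr" where
  "opp_at x = cnt_at (Plus (Minus (Reg 5) (Mem (col_at x))) x)"

definition tally :: "expr \<Rightarrow> expr \<Rightarrow> prog" where
  "tally x y = SetMem (cnt_at (Plus (Mem (col_at y)) x))
     (Plus (Mem (cnt_at (Plus (Mem (col_at y)) x))) (Const 1))"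

definition count_prog :: prog where
  "count_prog = Seq (for_loop 9 5 (SetMem (cnt_at (Reg 9)) (Const 0)))
     (for_loop 9 1 (Seq (tally (fst_end 9) (snd_end 9)) (tally (snd_end 9) (fst_end 9))))"

definition vote :: "expr \<Rightarrow> prog" where
  "vote x = If (Equal (Mem (col_at x)) (Const 0))
     (If (Less (Const 1) (Mem (cnt_at (Plus (Reg 0) x))))
        (SetMem (col_at x) (Reg 0))
        (If (Less (Const 1) (Mem (cnt_at (Plus (Plus (Reg 0) (Reg 0)) x))))
           (SetMem (col_at x) (Plus (Reg 0) (Reg 0))) Skip)) Skip"

definition vote_prog :: prog where
  "vote_prog = for_loop 9 0 (vote (Reg 9))"

text \<open>This realizes the rule \<open>sat\<close>, as \<open>vote\<close> does
  \<open>two\<close>: a positive counter for the color opposite to \<open>x\<close> shows a cut edge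
  at \<open>x\<close> with both ends decided.\<close>

definition push :: "expr \<Rightarrow> expr \<Rightarrow> prog" where
  "push x y = If (Conj (Equal (Mem (col_at y)) (Const 0)) (Less (Const 0) (Mem (opp_at x))))
     (SetMem (col_at y) (Mem (col_at x))) Skip"

definition push_prog :: prog where
  "push_prog = for_loop 9 1 (Seq (push (fst_end 9) (snd_end 9)) (push (snd_end 9) (fst_end 9)))"

definition round_prog :: prog where
  "round_prog = Seq count_prog (Seq vote_prog push_prog)"

definition color_expr :: "bool \<Rightarrow> expr" where
  "color_expr g = (if g then Reg 0 else Plus (Reg 0) (Reg 0))"

text \<open>The edge of register 6 is written last and so keeps two different colors even where the
  two edges overlap; the non-triviality of an accepted cut rests on this. Its orientation can be
  fixed because the two colors may be swapped, which leaves only \<open>g\<close> and the default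
  color to guess.\<close>

definition init_prog :: "bool \<Rightarrow> prog" where
  "init_prog g = Seq (for_loop 9 0 (SetMem (col_at (Reg 9)) (Const 0)))
     (Seq (SetMem (col_at (fst_end 7)) (color_expr g))
     (Seq (SetMem (col_at (snd_end 7)) (color_expr (\<not> g)))
     (Seq (SetMem (col_at (fst_end 6)) (color_expr True))
          (SetMem (col_at (snd_end 6)) (color_expr False)))))"

definition fill_prog :: "bool \<Rightarrow> prog" where
  "fill_prog d = for_loop 9 0 (If (Equal (Mem (col_at (Reg 9))) (Const 0))
     (SetMem (col_at (Reg 9)) (color_expr d)) Skip)"

text \<open>The answer cell is only ever set to 1 and so accumulates the disjunction over all
  attempts; the verdict on the current attempt has its own cell.\<close>

definition check_prog :: prog where
  "check_prog = Seq (SetMem (Plus (Reg 2) (Const 1)) (Const 1))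
     (Seq (for_loop 9 0 (If (Less (Const 1) (Mem (opp_at (Reg 9))))
        (SetMem (Plus (Reg 2) (Const 1)) (Const 0)) Skip))
     (If (Equal (Mem (Plus (Reg 2) (Const 1))) (Const 1)) (SetMem (Reg 2) (Const 1)) Skip))"

definition try_prog :: "bool \<Rightarrow> bool \<Rightarrow> prog" where
  "try_prog g d = Seq (init_prog g) (Seq (for_loop 8 0 round_prog)
     (Seq (fill_prog d) (Seq count_prog check_prog)))"

definition search_prog :: prog where
  "search_prog = for_loop 6 1 (for_loop 7 1
     (Seq (try_prog True True) (Seq (try_prog True False)
     (Seq (try_prog False True) (try_prog False False)))))"

definition matching_cut_prog :: prog where
  "matching_cut_prog = Seq (SetReg 2 (Plus (Reg 1) (Reg 1))) (Seq (SetReg 3 (Plus (Reg 2) (Const 2)))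
     (Seq (SetReg 4 (Plus (Reg 3) (Reg 0))) (Seq (SetReg 5 (Plus (Reg 0) (Plus (Reg 0) (Reg 0))))
     (Seq search_prog (SetReg 0 (Mem (Reg 2)))))))"

section \<open>Functional description of the memory contents\<close>

definition darts :: "('a \<times> 'a) list \<Rightarrow> ('a \<times> 'a) set" where
  "darts xs = set xs \<union> prod.swap ` set xs"

definition tallies :: "(nat \<times> nat) set \<Rightarrow> (nat \<Rightarrow> nat) \<Rightarrow> nat \<Rightarrow> nat" where
  "tallies D c x = card {p \<in> D. c (snd p) + fst p = x}"

lemma tallies_insert:
  "finite D \<Longrightarrow> (u, w) \<notin> D \<Longrightarrow>
   tallies (insert (u, w) D) c = (tallies D c)(c w + u := Suc (tallies D c (c w + u)))"
proof (rule ext)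
  fix x assume D: "finite D" "(u, w) \<notin> D"
  have "{p \<in> insert (u, w) D. c (snd p) + fst p = x} =
      (if c w + u = x then insert (u, w) {p \<in> D. c (snd p) + fst p = x}
       else {p \<in> D. c (snd p) + fst p = x})" by auto
  then show "tallies (insert (u, w) D) c x =
      ((tallies D c)(c w + u := Suc (tallies D c (c w + u)))) x"
    using D unfolding tallies_def by simp
qed

definition push_col :: "nat \<Rightarrow> (nat \<Rightarrow> nat) \<Rightarrow> nat \<Rightarrow> nat \<Rightarrow> (nat \<Rightarrow> nat) \<Rightarrow> nat \<Rightarrow> nat" where
  "push_col n t x y c = (if c y = 0 \<and> 0 < t (3 * n - c x + x) then c(y := c x) else c)"

text \<open>The counters \<open>t\<close> stay those from the start of the round while the colors
  change: recounting takes a pass over all edges and is done once per round.\<close>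

definition push_cols ::
    "nat \<Rightarrow> (nat \<Rightarrow> nat) \<Rightarrow> (nat \<times> nat) list \<Rightarrow> (nat \<Rightarrow> nat) \<Rightarrow> nat \<Rightarrow> nat" where
  "push_cols n t xs c = fold (\<lambda>(x, y) c. push_col n t y x (push_col n t x y c)) xs c"

definition vote_col :: "nat \<Rightarrow> (nat \<Rightarrow> nat) \<Rightarrow> (nat \<Rightarrow> nat) \<Rightarrow> nat \<Rightarrow> nat" where
  "vote_col n t c v = (if v < n \<and> c v = 0 then if 1 < t (n + v) then n else if 1 < t (2 * n + v) then 2 * n else 0
     else c v)"

definition fill_col :: "nat \<Rightarrow> (nat \<Rightarrow> nat) \<Rightarrow> nat \<Rightarrow> nat" where
  "fill_col a c v = (if c v = 0 then a else c v)"

definition code :: "nat \<Rightarrow> bool \<Rightarrow> nat" where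
  "code n g = (if g then n else 2 * n)"

locale edge_input =
  fixes n :: nat and es :: "(nat \<times> nat) list"
  assumes edge_less: "(u, v) \<in> set es \<Longrightarrow> u < n \<and> v < n \<and> u \<noteq> v"
    and edge_distinct: "distinct (map (\<lambda>(u, v). {u, v}) es)"
begin

abbreviation "m \<equiv> length es"
abbreviation "D \<equiv> darts es"

definition "col_base = 2 * m + 2"
definition "cnt_base = col_base + n"

text \<open>The map covers the whole memory, so that postconditions can be equations: edges, answer,
  verdict of the attempt, \<open>n\<close> colors, counters.\<close>

definition lay :: "nat \<Rightarrow> nat \<Rightarrow> (nat \<Rightarrow> nat) \<Rightarrow> (nat \<Rightarrow> nat) \<Rightarrow> nat \<Rightarrow> nat" where
  "lay ans ok c t a =
     (if a < 2 * m then (if even a then fst (es ! (a div 2)) else snd (es ! (a div 2)))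
      else if a = 2 * m then ans else if a = Suc (2 * m) then ok
      else if a < cnt_base then c (a - col_base) else t (a - cnt_base))"

lemma lay_simps:
  "i < m \<Longrightarrow> lay ans ok c t (i + i) = fst (es ! i)"
  "i < m \<Longrightarrow> lay ans ok c t (Suc (i + i)) = snd (es ! i)"
  "lay ans ok c t (2 * m) = ans"
  "lay ans ok c t (Suc (2 * m)) = ok"
  "v < n \<Longrightarrow> lay ans ok c t (col_base + v) = c v"
  "lay ans ok c t (cnt_base + x) = t x"
  by (auto simp: lay_def col_base_def cnt_base_def mult_2[symmetric])

lemma lay_upds:
  "(lay ans ok c t)(2 * m := x) = lay x ok c t"
  "(lay ans ok c t)(Suc (2 * m) := x) = lay ans x c t"
  "v < n \<Longrightarrow> (lay ans ok c t)(col_base + v := x) = lay ans ok (c(v := x)) t"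
  "(lay ans ok c t)(cnt_base + y := x) = lay ans ok c (t(y := x))"
  by (auto simp: lay_def col_base_def cnt_base_def fun_eq_iff)

lemma lay_cong: "(\<And>v. v < n \<Longrightarrow> c v = c' v) \<Longrightarrow> lay ans ok c t = lay ans ok c' t"
  by (auto simp: lay_def col_base_def cnt_base_def fun_eq_iff)

definition env :: "(nat \<Rightarrow> nat) \<Rightarrow> bool" where
  "env R \<longleftrightarrow> R 0 = n \<and> R 1 = m \<and> R 2 = 2 * m \<and> R 3 = col_base \<and> R 4 = cnt_base \<and> R 5 = 3 * n"

lemma env_simps:
  assumes "env R"
  shows "R 0 = n" "R (Suc 0) = m" "R 2 = 2 * m" "R 3 = col_base" "R 4 = cnt_base" "R 5 = 3 * n"
  using assms by (auto simp: env_def)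

lemma env_agree: "env R \<Longrightarrow> (\<And>k. k < 6 \<Longrightarrow> R' k = R k) \<Longrightarrow> env R'"
  by (auto simp: env_def)

lemmas expr_defs = fst_end_def snd_end_def col_at_def cnt_at_def opp_at_def color_expr_def

definition coloring :: "(nat \<Rightarrow> nat) \<Rightarrow> bool" where
  "coloring c \<longleftrightarrow> (\<forall>v. c v \<in> {0, n, 2 * n})"

lemma edge_nth: "i < m \<Longrightarrow> fst (es ! i) < n \<and> snd (es ! i) < n \<and> fst (es ! i) \<noteq> snd (es ! i)"
  using edge_less[of "fst (es ! i)" "snd (es ! i)"] by (metis nth_mem prod.collapse)

text \<open>Each increment of a counter must stand for a new dart. This holds because no edge is
  listed twice and the ends of an edge differ.\<close>

lemma darts_take_Suc:
  assumes "i < m"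
  shows "darts (take (Suc i) es) =
      insert (snd (es ! i), fst (es ! i)) (insert (fst (es ! i), snd (es ! i)) (darts (take i es)))"
    "(fst (es ! i), snd (es ! i)) \<notin> darts (take i es)"
    "(snd (es ! i), fst (es ! i)) \<notin> insert (fst (es ! i), snd (es ! i)) (darts (take i es))"
proof -
  show "darts (take (Suc i) es) =
      insert (snd (es ! i), fst (es ! i)) (insert (fst (es ! i), snd (es ! i)) (darts (take i es)))"
    using assms by (cases "es ! i") (auto simp: darts_def take_Suc_conv_app_nth)
  have ne: "{fst (es ! j), snd (es ! j)} \<noteq> {fst (es ! i), snd (es ! i)}" if "j < i" for j
    using that assms edge_distinct unfolding distinct_conv_nth
    by (auto simp: case_prod_unfold)
  have key: False if "(x, y) \<in> darts (take i es)" "{x, y} = {fst (es ! i), snd (es ! i)}" for x y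
  proof -
    have "(x, y) \<in> set (take i es) \<or> (y, x) \<in> set (take i es)"
      using that(1) by (auto simp: darts_def)
    then obtain j where "j < i" "es ! j = (x, y) \<or> es ! j = (y, x)"
      unfolding in_set_conv_nth using assms by auto
    moreover from this have "{fst (es ! j), snd (es ! j)} = {x, y}" by auto
    ultimately show False using ne[of j] that(2) by simp
  qed
  show "(fst (es ! i), snd (es ! i)) \<notin> darts (take i es)" using key by blast
  show "(snd (es ! i), fst (es ! i)) \<notin> insert (fst (es ! i), snd (es ! i)) (darts (take i es))"
    using key[OF _ insert_commute] edge_nth[OF assms] by (cases "es ! i") auto
qed

section \<open>Effect and running time of the single phases\<close>

lemma count_does:
  assumes R: "env R" and t: "\<forall>x\<ge>3 * n. t x = 0"
  shows "does count_prog 9 (R, lay ans ok c t) (\<lambda>M. M = lay ans ok c (tallies D c))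
     (100 * (n + m + 1))"
  unfolding count_prog_def
proof (rule does_Seq)
  let ?I = "\<lambda>i M. M = lay ans ok c (\<lambda>x. if x < i then 0 else t x)"
  have "does (for_loop 9 5 (SetMem (cnt_at (Reg 9)) (Const 0))) 9 (R, lay ans ok c t)
      (?I (3 * n)) (5 + 3 * n * (5 + 7))"
  proof (rule does_for)
    fix i R' M' assume *: "i < 3 * n" "\<And>k. k < 9 \<Longrightarrow> R' k = R k" "R' 9 = i" "?I i M'"
    have e: "env R'" by (rule env_agree[OF R]) (simp add: *(2))
    have "(\<lambda>x. if x < i then 0 else t x)(i := 0) = (\<lambda>x. if x < Suc i then 0 else t x)"
      by (auto simp: fun_eq_iff)
    then show "does (SetMem (cnt_at (Reg 9)) (Const 0)) (Suc 9) (R', M') (?I (Suc i)) 5"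
      using * by (intro does_SetMem) (simp_all add: expr_defs env_simps[OF e] lay_upds)
  qed (use R env_simps in auto)
  moreover have "(\<lambda>x. if x < 3 * n then 0 else t x) = (\<lambda>_. 0)" using t by (auto simp: fun_eq_iff)
  ultimately show "does (for_loop 9 5 (SetMem (cnt_at (Reg 9)) (Const 0))) 9 (R, lay ans ok c t)
      (\<lambda>M. M = lay ans ok c (\<lambda>_. 0)) (5 + 3 * n * (5 + 7))" by simp
next
  fix R1 M1 assume 1: "\<And>k. k < 9 \<Longrightarrow> R1 k = R k" "M1 = lay ans ok c (\<lambda>_. 0)"
  let ?I = "\<lambda>i M. M = lay ans ok c (tallies (darts (take i es)) c)"
  have R1: "env R1" by (rule env_agree[OF R]) (simp add: 1(1))
  have "does (for_loop 9 1 (Seq (tally (fst_end 9) (snd_end 9)) (tally (snd_end 9) (fst_end 9)))) 9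
      (R1, M1) (?I m) (5 + m * (80 + 7))"
  proof (rule does_for)
    show "?I 0 M1" using 1 by (simp add: darts_def tallies_def[abs_def])
    fix i R' M' assume *: "i < m" "\<And>k. k < 9 \<Longrightarrow> R' k = R1 k" "R' 9 = i" "?I i M'"
    have e: "env R'" by (rule env_agree[OF R1]) (simp add: *(2))
    let ?T = "darts (take i es)" and ?x = "fst (es ! i)" and ?y = "snd (es ! i)"
    have fin: "finite ?T" by (simp add: darts_def)
    note ed = edge_nth[OF *(1)] darts_take_Suc[OF *(1)]
    show "does (Seq (tally (fst_end 9) (snd_end 9)) (tally (snd_end 9) (fst_end 9))) (Suc 9) (R', M')
        (?I (Suc i)) 80"
    proof (rule does_Seq)
      show "does (tally (fst_end 9) (snd_end 9)) (Suc 9) (R', M')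
          (\<lambda>M. M = lay ans ok c (tallies (insert (?x, ?y) ?T) c)) 40"
        unfolding tally_def tallies_insert[OF fin ed(3)]
        using * ed(1) by (intro does_SetMem)
          (simp_all add: expr_defs env_simps[OF e] lay_upds lay_simps)
      fix R2 M2 assume 2: "\<And>k. k < Suc 9 \<Longrightarrow> R2 k = R' k"
        "M2 = lay ans ok c (tallies (insert (?x, ?y) ?T) c)"
      have e2: "env R2" by (rule env_agree[OF e]) (simp add: 2(1))
      have fin2: "finite (insert (?x, ?y) ?T)" using fin by simp
      have r9: "R2 9 = i" using 2 * by simp
      show "does (tally (snd_end 9) (fst_end 9)) (Suc 9) (R2, M2) (?I (Suc i)) 40"
        unfolding tally_def ed(2) tallies_insert[OF fin2 ed(4)]
        using * ed(1) 2(2) by (intro does_SetMem)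
          (simp_all add: expr_defs env_simps[OF e2] lay_upds lay_simps r9)
    qed simp
  qed (use R1 env_simps in auto)
  then show "does (for_loop 9 1 (Seq (tally (fst_end 9) (snd_end 9)) (tally (snd_end 9) (fst_end 9)))) 9
      (R1, M1) (\<lambda>M. M = lay ans ok c (tallies D c)) (5 + m * (80 + 7))" by simp
qed simp

lemma vote1_does:
  assumes R: "env R" and i: "R r = i" "i < n"
  shows "does (vote (Reg r)) d (R, lay ans ok c t)
     (\<lambda>M. M = lay ans ok (c(i := vote_col n t c i)) t) 80"
proof -
  note simps = expr_defs env_simps[OF R] lay_simps lay_upds vote_col_def i mult_2
  have same: "vote_col n t c i = c i \<Longrightarrow> lay ans ok (c(i := vote_col n t c i)) t = lay ans ok c t"
    by simp
  show ?thesis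
    unfolding vote_def
    apply (rule does_If[where T' = 60])
      apply (rule does_If[where T' = 40])
        apply (rule does_SetMem)
         apply (simp add: simps)
        apply (simp add: simps)
       apply (rule does_If[where T' = 20])
         apply (rule does_SetMem)
          apply (simp add: simps)
         apply (simp add: simps)
        apply (rule does_Skip)
         apply (subst same; simp add: simps)
        apply simp
       apply (simp add: simps)
      apply (simp add: simps)
     apply (rule does_Skip)
      apply (subst same; simp add: simps)
     apply simp
    apply (simp add: simps)
    done
qed

lemma vote_does:
  assumes R: "env R"
  shows "does vote_prog 9 (R, lay ans ok c t) (\<lambda>M. M = lay ans ok (vote_col n t c) t) (100 * (n + 1))"
proof -
  let ?I = "\<lambda>i M. M = lay ans ok (\<lambda>v. if v < i then vote_col n t c v else c v) t"
  have "does vote_prog 9 (R, lay ans ok c t) (?I n) (5 + n * (80 + 7))"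
    unfolding vote_prog_def
  proof (rule does_for[where I = ?I])
    fix i R' M' assume *: "i < n" "\<And>k. k < 9 \<Longrightarrow> R' k = R k" "R' 9 = i" "?I i M'"
    have e: "env R'" by (rule env_agree[OF R]) (simp add: *(2))
    let ?c = "\<lambda>v. if v < i then vote_col n t c v else c v"
    \<comment> \<open>Voting in place is harmless, since \<open>vote_col\<close> reads the coloring
      only at the vertex itself.\<close>
    have "?c(i := vote_col n t ?c i) = (\<lambda>v. if v < Suc i then vote_col n t c v else c v)"
      by (auto simp: fun_eq_iff vote_col_def)
    with vote1_does[OF e *(3,1), of "Suc 9" ans ok ?c t]
    show "does (vote (Reg 9)) (Suc 9) (R', M') (?I (Suc i)) 80"
      unfolding *(4) by simp
  qed (use R env_simps in auto)
  moreover have "lay ans ok (\<lambda>v. if v < n then vote_col n t c v else c v) t = lay ans ok (vote_col n t c) t"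
    by (rule lay_cong) simp
  ultimately show ?thesis by (auto elim!: does_mono)
qed

lemma push1_does:
  assumes R: "env R" and x: "expr_val ex (R, lay ans ok c t) = x" "x < n" "expr_cost ex \<le> 6"
    and y: "expr_val ey (R, lay ans ok c t) = y" "y < n" "expr_cost ey \<le> 6"
  shows "does (push ex ey) d (R, lay ans ok c t) (\<lambda>M. M = lay ans ok (push_col n t x y c) t) 80"
  unfolding push_def
  apply (rule does_If[where T' = 30])
    apply (rule does_SetMem)
     apply (use x y in \<open>simp add: expr_defs env_simps[OF R] lay_simps lay_upds push_col_def\<close>)
    apply (use x y in \<open>simp add: expr_defs\<close>)
   apply (rule does_Skip)
    apply (use x y in \<open>auto simp add: expr_defs env_simps[OF R] lay_simps lay_upds push_col_def\<close>)
  done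

lemma push_does:
  assumes R: "env R"
  shows "does push_prog 9 (R, lay ans ok c t) (\<lambda>M. M = lay ans ok (push_cols n t es c) t) (200 * (m + 1))"
proof -
  let ?I = "\<lambda>i M. M = lay ans ok (push_cols n t (take i es) c) t"
  have "does push_prog 9 (R, lay ans ok c t) (?I m) (5 + m * (160 + 7))"
    unfolding push_prog_def
  proof (rule does_for[where I = ?I])
    fix i R' M' assume *: "i < m" "\<And>k. k < 9 \<Longrightarrow> R' k = R k" "R' 9 = i" "?I i M'"
    have e: "env R'" by (rule env_agree[OF R]) (simp add: *(2))
    note ed = edge_nth[OF *(1)]
    let ?c = "push_cols n t (take i es) c" and ?x = "fst (es ! i)" and ?y = "snd (es ! i)"
    have st: "push_cols n t (take (Suc i) es) c = push_col n t ?y ?x (push_col n t ?x ?y ?c)"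
      using *(1) by (simp add: push_cols_def take_Suc_conv_app_nth case_prod_unfold)
    show "does (Seq (push (fst_end 9) (snd_end 9)) (push (snd_end 9) (fst_end 9))) (Suc 9) (R', M')
        (?I (Suc i)) 160"
    proof (rule does_Seq)
      show "does (push (fst_end 9) (snd_end 9)) (Suc 9) (R', M')
          (\<lambda>M. M = lay ans ok (push_col n t ?x ?y ?c) t) 80"
        unfolding *(4) using * ed by (intro push1_does[OF e]) (simp_all add: expr_defs lay_simps)
      fix R2 M2 assume 2: "\<And>k. k < Suc 9 \<Longrightarrow> R2 k = R' k"
        "M2 = lay ans ok (push_col n t ?x ?y ?c) t"
      have e2: "env R2" by (rule env_agree[OF e]) (simp add: 2(1))
      have r9: "R2 9 = i" using 2 * by simp
      show "does (push (snd_end 9) (fst_end 9)) (Suc 9) (R2, M2) (?I (Suc i)) 80"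
        unfolding 2(2) st using * ed by (intro push1_does[OF e2]) (simp_all add: expr_defs lay_simps r9)
    qed simp
  qed (use R env_simps in \<open>auto simp: push_cols_def\<close>)
  then show ?thesis by (auto elim!: does_mono)
qed

text \<open>Only the first \<open>3 * n\<close> counters are reset by \<open>count_prog\<close>; the
  cells behind them must be 0 already for the result to equal \<open>tallies D c\<close>.\<close>

definition clean :: "(nat \<Rightarrow> nat) \<Rightarrow> bool" where
  "clean t \<longleftrightarrow> (\<forall>x\<ge>3 * n. t x = 0)"

definition round_col :: "(nat \<Rightarrow> nat) \<Rightarrow> nat \<Rightarrow> nat" where
  "round_col c = push_cols n (tallies D c) es (vote_col n (tallies D c) c)"

definition init_col :: "bool \<Rightarrow> nat \<times> nat \<Rightarrow> nat \<times> nat \<Rightarrow> nat \<Rightarrow> nat" where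
  "init_col g e e' = (\<lambda>_. 0)(fst e' := code n g, snd e' := code n (\<not> g),
     fst e := code n True, snd e := code n False)"

definition final_col :: "bool \<Rightarrow> bool \<Rightarrow> nat \<times> nat \<Rightarrow> nat \<times> nat \<Rightarrow> nat \<Rightarrow> nat" where
  "final_col g d e e' = fill_col (code n d) ((round_col ^^ n) (init_col g e e'))"

definition accepts :: "bool \<Rightarrow> bool \<Rightarrow> nat \<times> nat \<Rightarrow> nat \<times> nat \<Rightarrow> bool" where
  "accepts g d e e' \<longleftrightarrow>
     (\<forall>v<n. tallies D (final_col g d e e') (3 * n - final_col g d e e' v + v) \<le> 1)"

text \<open>The invariant between attempts: colors and counters may be left over from the previous
  one.\<close>

definition found :: "nat \<Rightarrow> (nat \<Rightarrow> nat) \<Rightarrow> bool" where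
  "found ans M \<longleftrightarrow> (\<exists>ok c t. clean t \<and> M = lay ans ok c t)"

lemma coloring_push: "coloring c \<Longrightarrow> coloring (push_col n t x y c)"
  by (auto simp: coloring_def push_col_def)

lemma coloring_push_cols: "coloring c \<Longrightarrow> coloring (push_cols n t xs c)"
  unfolding push_cols_def by (induction xs arbitrary: c) (auto simp: coloring_push)

lemma coloring_vote: "coloring c \<Longrightarrow> coloring (vote_col n t c)"
  by (auto simp: coloring_def vote_col_def)

lemma coloring_round: "coloring c \<Longrightarrow> coloring (round_col c)"
  unfolding round_col_def by (intro coloring_push_cols coloring_vote)

lemma coloring_rounds: "coloring c \<Longrightarrow> coloring ((round_col ^^ k) c)"
  by (induction k) (auto simp: coloring_round)

lemma coloring_init: "coloring (init_col g e e')"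
  by (auto simp: coloring_def init_col_def code_def)

lemma coloring_fill: "coloring c \<Longrightarrow> coloring (fill_col (code n d) c)"
  unfolding coloring_def fill_col_def code_def by (metis insertCI)

lemma darts_less: "(u, w) \<in> D \<Longrightarrow> u < n \<and> w < n"
  using edge_less by (auto simp: darts_def)

lemma clean_tallies:
  assumes "coloring c"
  shows "clean (tallies D c)"
  unfolding clean_def
proof (intro allI impI)
  fix x assume x: "3 * n \<le> x"
  have "c w + u \<noteq> x" if uw: "(u, w) \<in> D" for u w
  proof -
    have "c w \<in> {0, n, 2 * n}" using assms by (auto simp: coloring_def)
    then have "c w \<le> 2 * n" by auto
    then show ?thesis using x darts_less[OF uw] by linarith
  qed
  then have "{p \<in> D. c (snd p) + fst p = x} = {}" by auto
  then show "tallies D c x = 0" unfolding tallies_def by (simp only: card.empty)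
qed

lemma round_does:
  assumes R: "env R" and t: "clean t"
  shows "does round_prog 9 (R, lay ans ok c t)
     (\<lambda>M. M = lay ans ok (round_col c) (tallies D c)) (400 * (n + m + 1))"
  unfolding round_prog_def
proof (rule does_Seq)
  show "does count_prog 9 (R, lay ans ok c t) (\<lambda>M. M = lay ans ok c (tallies D c)) (100 * (n + m + 1))"
    using count_does[OF R] t unfolding clean_def by blast
  fix R1 M1 assume 1: "\<And>k. k < 9 \<Longrightarrow> R1 k = R k" "M1 = lay ans ok c (tallies D c)"
  have R1: "env R1" by (rule env_agree[OF R]) (simp add: 1(1))
  show "does (Seq vote_prog push_prog) 9 (R1, M1)
     (\<lambda>M. M = lay ans ok (round_col c) (tallies D c)) (300 * (n + m + 1))"
    unfolding 1(2)
  proof (rule does_Seq[OF vote_does[OF R1]])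
    fix R2 M2 assume 2: "\<And>k. k < 9 \<Longrightarrow> R2 k = R1 k"
      "M2 = lay ans ok (vote_col n (tallies D c) c) (tallies D c)"
    have R2: "env R2" by (rule env_agree[OF R1]) (simp add: 2(1))
    show "does push_prog 9 (R2, M2) (\<lambda>M. M = lay ans ok (round_col c) (tallies D c)) (200 * (m + 1))"
      using push_does[OF R2] by (simp add: 2(2) round_col_def)
  qed simp
qed simp

lemma rounds_does:
  assumes R: "env R" and t: "clean t" and c: "coloring c"
  shows "does (for_loop 8 0 round_prog) 8 (R, lay ans ok c t)
     (\<lambda>M. \<exists>t. clean t \<and> M = lay ans ok ((round_col ^^ n) c) t) (5 + n * (400 * (n + m + 1) + 7))"
proof -
  let ?I = "\<lambda>i M. \<exists>t. clean t \<and> M = lay ans ok ((round_col ^^ i) c) t"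
  have "does (for_loop 8 0 round_prog) 8 (R, lay ans ok c t) (?I n) (5 + n * (400 * (n + m + 1) + 7))"
  proof (rule does_for[where I = ?I])
    show "?I 0 (lay ans ok c t)" using t by auto
    fix i R' M' assume *: "i < n" "\<And>k. k < 8 \<Longrightarrow> R' k = R k" "R' 8 = i" "?I i M'"
    have e: "env R'" by (rule env_agree[OF R]) (simp add: *(2))
    from *(4) obtain t' where t': "clean t'" "M' = lay ans ok ((round_col ^^ i) c) t'" by blast
    show "does round_prog (Suc 8) (R', M') (?I (Suc i)) (400 * (n + m + 1))"
      unfolding t'(2)
      by (rule does_mono[OF round_does[OF e t'(1)]])
        (use clean_tallies[OF coloring_rounds[OF c]] in auto)
  qed (use R env_simps in auto)
  then show ?thesis .
qed

lemma color_expr_val: "env R \<Longrightarrow> expr_val (color_expr g) (R, M) = code n g"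
  by (simp add: color_expr_def code_def env_simps)

lemma color_expr_cost: "expr_cost (color_expr g) \<le> 3"
  by (simp add: color_expr_def)

lemma set_col_does:
  assumes R: "env R" and x: "expr_val x (R, lay ans ok c t) = v" "v < n" "expr_cost x \<le> 6"
  shows "does (SetMem (col_at x) (color_expr g)) d (R, lay ans ok c t)
     (\<lambda>M. M = lay ans ok (c(v := code n g)) t) 15"
  using x color_expr_cost[of g]
  by (intro does_SetMem) (simp_all add: color_expr_val[OF R] col_at_def env_simps[OF R] lay_upds)

lemma init_does:
  assumes R: "env R" "R 6 = i" "i < m" "R 7 = j" "j < m"
  shows "does (init_prog g) 8 (R, lay ans ok c t)
     (\<lambda>M. M = lay ans ok (init_col g (es ! i) (es ! j)) t) (100 * (n + m + 1))"
  unfolding init_prog_def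
proof (rule does_Seq)
  let ?I = "\<lambda>i M. M = lay ans ok (\<lambda>v. if v < i then 0 else c v) t"
  have "does (for_loop 9 0 (SetMem (col_at (Reg 9)) (Const 0))) 9 (R, lay ans ok c t)
      (?I n) (5 + n * (5 + 7))"
  proof (rule does_for[where I = ?I])
    fix i R' M' assume *: "i < n" "\<And>k. k < 9 \<Longrightarrow> R' k = R k" "R' 9 = i" "?I i M'"
    have e: "env R'" by (rule env_agree[OF R(1)]) (simp add: *(2))
    have "(\<lambda>x. if x < i then 0 else c x)(i := 0) = (\<lambda>x. if x < Suc i then 0 else c x)"
      by (auto simp: fun_eq_iff)
    then show "does (SetMem (col_at (Reg 9)) (Const 0)) (Suc 9) (R', M') (?I (Suc i)) 5"
      using * by (intro does_SetMem) (simp_all add: expr_defs env_simps[OF e] lay_upds)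
  qed (use R env_simps in auto)
  moreover have "lay ans ok (\<lambda>x. if x < n then 0 else c x) t = lay ans ok (\<lambda>_. 0) t"
    by (rule lay_cong) simp
  ultimately show "does (for_loop 9 0 (SetMem (col_at (Reg 9)) (Const 0))) 8 (R, lay ans ok c t)
      (\<lambda>M. M = lay ans ok (\<lambda>_. 0) t) (5 + n * (5 + 7))" by (auto elim!: does_mono)
  fix R1 M1 assume 1: "\<And>k. k < 8 \<Longrightarrow> R1 k = R k" "M1 = lay ans ok (\<lambda>_. 0) t"
  have fst_set: "does (SetMem (col_at (fst_end r)) (color_expr h)) 8 (R', lay ans ok c t)
      (\<lambda>M. M = lay ans ok (c(fst (es ! q) := code n h)) t) 15"
    if "\<And>k. k < 8 \<Longrightarrow> R' k = R k" "R r = q" "q < m" "r < 8" for r q R' c h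
  proof (rule set_col_does)
    show "env R'" by (rule env_agree[OF R(1)]) (simp add: that(1))
    show "expr_val (fst_end r) (R', lay ans ok c t) = fst (es ! q)"
      using that by (simp add: fst_end_def lay_simps)
  qed (use edge_nth[OF that(3)] in \<open>simp_all add: fst_end_def\<close>)
  have snd_set: "does (SetMem (col_at (snd_end r)) (color_expr h)) 8 (R', lay ans ok c t)
      (\<lambda>M. M = lay ans ok (c(snd (es ! q) := code n h)) t) 15"
    if "\<And>k. k < 8 \<Longrightarrow> R' k = R k" "R r = q" "q < m" "r < 8" for r q R' c h
  proof (rule set_col_does)
    show "env R'" by (rule env_agree[OF R(1)]) (simp add: that(1))
    show "expr_val (snd_end r) (R', lay ans ok c t) = snd (es ! q)"
      using that by (simp add: snd_end_def lay_simps)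
  qed (use edge_nth[OF that(3)] in \<open>simp_all add: snd_end_def\<close>)
  show "does (Seq (SetMem (col_at (fst_end 7)) (color_expr g))
     (Seq (SetMem (col_at (snd_end 7)) (color_expr (\<not> g)))
     (Seq (SetMem (col_at (fst_end 6)) (color_expr True))
          (SetMem (col_at (snd_end 6)) (color_expr False))))) 8 (R1, M1)
     (\<lambda>M. M = lay ans ok (init_col g (es ! i) (es ! j)) t) 60"
    unfolding 1(2)
  proof (rule does_Seq[OF fst_set[OF 1(1) R(4,5)]])
    fix R2 M2 assume 2: "\<And>k. k < 8 \<Longrightarrow> R2 k = R1 k"
      "M2 = lay ans ok ((\<lambda>_. 0)(fst (es ! j) := code n g)) t"
    have a2: "R2 k = R k" if "k < 8" for k using 1(1) 2(1) that by simp
    show "does (Seq (SetMem (col_at (snd_end 7)) (color_expr (\<not> g)))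
       (Seq (SetMem (col_at (fst_end 6)) (color_expr True))
            (SetMem (col_at (snd_end 6)) (color_expr False)))) 8 (R2, M2)
       (\<lambda>M. M = lay ans ok (init_col g (es ! i) (es ! j)) t) 45"
      unfolding 2(2)
    proof (rule does_Seq[OF snd_set[OF a2 R(4,5)]])
      fix R3 M3 assume 3: "\<And>k. k < 8 \<Longrightarrow> R3 k = R2 k"
        "M3 = lay ans ok ((\<lambda>_. 0)(fst (es ! j) := code n g, snd (es ! j) := code n (\<not> g))) t"
      have a3: "R3 k = R k" if "k < 8" for k using a2 3(1) that by simp
      show "does (Seq (SetMem (col_at (fst_end 6)) (color_expr True))
            (SetMem (col_at (snd_end 6)) (color_expr False))) 8 (R3, M3)
         (\<lambda>M. M = lay ans ok (init_col g (es ! i) (es ! j)) t) 30"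
        unfolding 3(2)
      proof (rule does_Seq[OF fst_set[OF a3 R(2,3)]])
        fix R4 M4 assume 4: "\<And>k. k < 8 \<Longrightarrow> R4 k = R3 k"
          "M4 = lay ans ok ((\<lambda>_. 0)(fst (es ! j) := code n g, snd (es ! j) := code n (\<not> g),
             fst (es ! i) := code n True)) t"
        have a4: "R4 k = R k" if "k < 8" for k using a3 4(1) that by simp
        show "does (SetMem (col_at (snd_end 6)) (color_expr False)) 8 (R4, M4)
         (\<lambda>M. M = lay ans ok (init_col g (es ! i) (es ! j)) t) 15"
          unfolding 4(2) init_col_def by (rule snd_set[OF a4 R(2,3)]) simp_all
      qed simp_all
    qed simp_all
  qed simp_all
qed simp

lemma fill_does:
  assumes R: "env R"
  shows "does (fill_prog d) 8 (R, lay ans ok c t)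
     (\<lambda>M. M = lay ans ok (fill_col (code n d) c) t) (100 * (n + m + 1))"
proof -
  let ?I = "\<lambda>i M. M = lay ans ok (\<lambda>v. if v < i then fill_col (code n d) c v else c v) t"
  have "does (fill_prog d) 9 (R, lay ans ok c t) (?I n) (5 + n * (40 + 7))"
    unfolding fill_prog_def
  proof (rule does_for[where I = ?I])
    fix i R' M' assume *: "i < n" "\<And>k. k < 9 \<Longrightarrow> R' k = R k" "R' 9 = i" "?I i M'"
    have e: "env R'" by (rule env_agree[OF R]) (simp add: *(2))
    let ?c = "\<lambda>v. if v < i then fill_col (code n d) c v else c v"
    have u: "c i = 0 \<Longrightarrow> ?c(i := code n d) = (\<lambda>v. if v < Suc i then fill_col (code n d) c v else c v)"
      and u': "c i \<noteq> 0 \<Longrightarrow> ?c = (\<lambda>v. if v < Suc i then fill_col (code n d) c v else c v)"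
      by (auto simp: fun_eq_iff fill_col_def less_Suc_eq)
    show "does (If (Equal (Mem (col_at (Reg 9))) (Const 0)) (SetMem (col_at (Reg 9)) (color_expr d)) Skip)
        (Suc 9) (R', M') (?I (Suc i)) 40"
      unfolding *(4)
    proof (rule does_If[where T' = 15])
      assume "test_val (Equal (Mem (col_at (Reg 9))) (Const 0)) (R', lay ans ok ?c t)"
      then have "c i = 0" using * by (simp add: col_at_def env_simps[OF e] lay_simps)
      from set_col_does[OF e, of "Reg 9" ans ok ?c t i d "Suc 9"] * u[OF this]
      show "does (SetMem (col_at (Reg 9)) (color_expr d)) (Suc 9) (R', lay ans ok ?c t) (?I (Suc i)) 15"
        by simp
    next
      assume "\<not> test_val (Equal (Mem (col_at (Reg 9))) (Const 0)) (R', lay ans ok ?c t)"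
      then have "c i \<noteq> 0" using * by (simp add: col_at_def env_simps[OF e] lay_simps)
      from u'[OF this] show "does Skip (Suc 9) (R', lay ans ok ?c t) (?I (Suc i)) 15"
        by (intro does_Skip) simp_all
    qed (simp add: col_at_def)
  qed (use R env_simps in auto)
  moreover have "lay ans ok (\<lambda>v. if v < n then fill_col (code n d) c v else c v) t =
      lay ans ok (fill_col (code n d) c) t"
    by (rule lay_cong) simp
  ultimately show ?thesis by (auto elim!: does_mono)
qed

lemma check_does:
  assumes R: "env R" and t: "clean t"
  shows "does check_prog 8 (R, lay ans ok c t)
     (found (if \<forall>v<n. t (3 * n - c v + v) \<le> 1 then 1 else ans)) (100 * (n + m + 1))"
  unfolding check_prog_def
proof (rule does_Seq)
  show "does (SetMem (Plus (Reg 2) (Const 1)) (Const 1)) 8 (R, lay ans ok c t) 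
      (\<lambda>M. M = lay ans 1 c t) 5"
    by (intro does_SetMem) (simp_all add: env_simps[OF R] lay_upds)
  fix R1 M1 assume 1: "\<And>k. k < 8 \<Longrightarrow> R1 k = R k" "M1 = lay ans 1 c t"
  have R1: "env R1" by (rule env_agree[OF R]) (simp add: 1(1))
  let ?J = "\<lambda>i::nat. if \<forall>v<i. t (3 * n - c v + v) \<le> 1 then 1 else 0"
  let ?I = "\<lambda>i M. M = lay ans (?J i) c t"
  let ?body = "If (Less (Const 1) (Mem (opp_at (Reg 9)))) (SetMem (Plus (Reg 2) (Const 1)) (Const 0)) Skip"
  show "does (Seq (for_loop 9 0 ?body)
     (If (Equal (Mem (Plus (Reg 2) (Const 1))) (Const 1)) (SetMem (Reg 2) (Const 1)) Skip)) 8 (R1, M1)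
     (found (if \<forall>v<n. t (3 * n - c v + v) \<le> 1 then 1 else ans)) (50 * (n + 1))"
  proof (rule does_Seq)
    have "does (for_loop 9 0 ?body) 9 (R1, M1) (?I n) (5 + n * (40 + 7))"
    proof (rule does_for[where I = ?I])
      fix i R' M' assume *: "i < n" "\<And>k. k < 9 \<Longrightarrow> R' k = R1 k" "R' 9 = i" "?I i M'"
      have e: "env R'" by (rule env_agree[OF R1]) (simp add: *(2))
      have tv: "test_val (Less (Const 1) (Mem (opp_at (Reg 9)))) (R', M') \<longleftrightarrow> \<not> t (3 * n - c i + i) \<le> 1"
        using * by (auto simp: expr_defs env_simps[OF e] lay_simps)
      show "does ?body (Suc 9) (R', M') (?I (Suc i)) 40"
      proof (rule does_If[where T' = 5])
        assume "test_val (Less (Const 1) (Mem (opp_at (Reg 9)))) (R', M')"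
        then have J: "\<not> (\<forall>v<Suc i. t (3 * n - c v + v) \<le> 1)" unfolding tv by auto
        then show "does (SetMem (Plus (Reg 2) (Const 1)) (Const 0)) (Suc 9) (R', M') (?I (Suc i)) 5"
          unfolding if_not_P[OF J] using *(4) by (intro does_SetMem) (simp_all add: env_simps[OF e] lay_upds)
      next
        assume "\<not> test_val (Less (Const 1) (Mem (opp_at (Reg 9)))) (R', M')"
        then have "?J (Suc i) = ?J i" unfolding tv by (auto simp: less_Suc_eq)
        then show "does Skip (Suc 9) (R', M') (?I (Suc i)) 5"
          unfolding *(4) by (intro does_Skip) (simp only: \<open>?J (Suc i) = ?J i\<close>, simp)
      qed (simp add: expr_defs)
    qed (use R1 env_simps 1(2) in auto)
    then show "does (for_loop 9 0 ?body) 8 (R1, M1) (?I n) (5 + n * (40 + 7))" 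
      by (rule does_mono) simp_all
    fix R2 M2 assume 2: "\<And>k. k < 8 \<Longrightarrow> R2 k = R1 k" "?I n M2"
    have R2: "env R2" by (rule env_agree[OF R1]) (simp add: 2(1))
    show "does (If (Equal (Mem (Plus (Reg 2) (Const 1))) (Const 1)) (SetMem (Reg 2) (Const 1)) Skip) 8 (R2, M2)
     (found (if \<forall>v<n. t (3 * n - c v + v) \<le> 1 then 1 else ans)) 20"
    proof (cases "\<forall>v<n. t (3 * n - c v + v) \<le> 1")
      case True
      then have M2: "M2 = lay ans 1 c t" using 2(2) by auto
      show ?thesis
        unfolding if_P[OF True] M2
        by (rule does_If[where T' = 3], rule does_SetMem)
          (use t in \<open>auto simp: env_simps[OF R2] lay_simps lay_upds found_def\<close>)
    next
      case False
      then have M2: "M2 = lay ans 0 c t" using 2(2) by auto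
      show ?thesis
        unfolding if_not_P[OF False] M2
        by (rule does_If[where T' = 3], simp add: env_simps[OF R2] lay_simps, rule does_Skip)
          (use t in \<open>auto simp: env_simps[OF R2] lay_simps lay_upds found_def\<close>)
    qed
  qed simp
qed simp

text \<open>The dominant part is \<open>n\<close> rounds of at most \<open>400 * (n + m + 1)\<close>
  steps; the factor 1000 also absorbs initialization, filling and checking.\<close>

definition try_time :: nat where
  "try_time = 1000 * (n + 1) * (n + m + 1)"

lemma try_does:
  assumes R: "env R" "R 6 = i" "i < m" "R 7 = j" "j < m" and M: "found ans M"
  shows "does (try_prog g d) 8 (R, M) (found (if accepts g d (es ! i) (es ! j) then 1 else ans)) try_time"
proof -
  obtain ok c t where t: "clean t" and M: "M = lay ans ok c t" using M by (auto simp: found_def)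
  let ?c = "init_col g (es ! i) (es ! j)"
  let ?T = "100 * (n + m + 1)"
  show ?thesis
    unfolding try_prog_def M
  proof (rule does_Seq[OF init_does[OF R]])
    fix R1 M1 assume 1: "\<And>k. k < 8 \<Longrightarrow> R1 k = R k" "M1 = lay ans ok ?c t"
    have R1: "env R1" by (rule env_agree[OF R(1)]) (simp add: 1(1))
    show "does (Seq (for_loop 8 0 round_prog) (Seq (fill_prog d) (Seq count_prog check_prog))) 8 (R1, M1)
       (found (if accepts g d (es ! i) (es ! j) then 1 else ans))
       (5 + n * (400 * (n + m + 1) + 7) + 3 * ?T)"
      unfolding 1(2)
    proof (rule does_Seq[OF rounds_does[OF R1 t coloring_init]])
      fix R2 M2 assume 2: "\<And>k. k < 8 \<Longrightarrow> R2 k = R1 k"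
        "\<exists>t. clean t \<and> M2 = lay ans ok ((round_col ^^ n) ?c) t"
      then obtain t2 where t2: "clean t2" "M2 = lay ans ok ((round_col ^^ n) ?c) t2" by blast
      have R2: "env R2" by (rule env_agree[OF R1]) (simp add: 2(1))
      show "does (Seq (fill_prog d) (Seq count_prog check_prog)) 8 (R2, M2)
         (found (if accepts g d (es ! i) (es ! j) then 1 else ans)) (3 * ?T)"
        unfolding t2(2)
      proof (rule does_Seq[OF fill_does[OF R2]])
        fix R3 M3 assume 3: "\<And>k. k < 8 \<Longrightarrow> R3 k = R2 k"
          "M3 = lay ans ok (fill_col (code n d) ((round_col ^^ n) ?c)) t2"
        have R3: "env R3" by (rule env_agree[OF R2]) (simp add: 3(1))
        let ?f = "final_col g d (es ! i) (es ! j)"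
        have M3: "M3 = lay ans ok ?f t2" using 3(2) by (simp add: final_col_def)
        have cf: "coloring ?f"
          unfolding final_col_def by (intro coloring_fill coloring_rounds coloring_init)
        show "does (Seq count_prog check_prog) 8 (R3, M3)
         (found (if accepts g d (es ! i) (es ! j) then 1 else ans)) (2 * ?T)"
          unfolding M3
        proof (rule does_Seq)
          show "does count_prog 8 (R3, lay ans ok ?f t2) (\<lambda>M. M = lay ans ok ?f (tallies D ?f)) ?T"
            by (rule does_mono[OF count_does[OF R3]]) (use t2(1) in \<open>simp_all add: clean_def\<close>)
          fix R4 M4 assume 4: "\<And>k. k < 8 \<Longrightarrow> R4 k = R3 k" "M4 = lay ans ok ?f (tallies D ?f)"
          have R4: "env R4" by (rule env_agree[OF R3]) (simp add: 4(1))
          show "does check_prog 8 (R4, M4) (found (if accepts g d (es ! i) (es ! j) then 1 else ans)) ?T"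
            using check_does[OF R4 clean_tallies[OF cf]] unfolding 4(2) accepts_def .
        qed simp
      qed simp
    qed simp
  qed (simp add: try_time_def algebra_simps)
qed

definition accepting :: "nat \<Rightarrow> nat \<Rightarrow> bool" where
  "accepting i j \<longleftrightarrow> (\<exists>g d. accepts g d (es ! i) (es ! j))"

lemma tries_does:
  assumes R: "env R" "R 6 = i" "i < m" "R 7 = j" "j < m" and M: "found (if Q then 1 else 0) M"
  shows "does (Seq (try_prog True True) (Seq (try_prog True False)
     (Seq (try_prog False True) (try_prog False False)))) 8 (R, M)
     (found (if Q \<or> accepting i j then 1 else 0)) (4 * try_time)"
proof -
  have keep: "env R'" "R' 6 = i" "R' 7 = j" if "\<And>k. k < 8 \<Longrightarrow> R' k = R k" for R'
    using that R env_agree[OF R(1), of R'] by simp_all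
  have attempt: "does (try_prog g d) 8 (R', M') (found (if Q' \<or> accepts g d (es ! i) (es ! j) then 1 else 0)) try_time"
    if "\<And>k. k < 8 \<Longrightarrow> R' k = R k" "found (if Q' then 1 else 0) M'" for g d R' M' Q'
    using try_does[OF keep(1)[OF that(1)] keep(2)[OF that(1)] R(3) keep(3)[OF that(1)] R(5) that(2), of g d]
    by (rule does_mono) (auto split: if_splits)
  show ?thesis
  proof (rule does_Seq[OF attempt[OF _ M]])
    fix R1 M1 assume 1: "\<And>k. k < 8 \<Longrightarrow> R1 k = R k"
      "found (if Q \<or> accepts True True (es ! i) (es ! j) then 1 else 0) M1"
    show "does (Seq (try_prog True False) (Seq (try_prog False True) (try_prog False False))) 8 (R1, M1)
     (found (if Q \<or> accepting i j then 1 else 0)) (3 * try_time)"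
    proof (rule does_Seq[OF attempt[OF 1]])
      fix R2 M2 assume 2: "\<And>k. k < 8 \<Longrightarrow> R2 k = R1 k"
        "found (if (Q \<or> accepts True True (es ! i) (es ! j)) \<or> accepts True False (es ! i) (es ! j) then 1 else 0) M2"
      show "does (Seq (try_prog False True) (try_prog False False)) 8 (R2, M2)
         (found (if Q \<or> accepting i j then 1 else 0)) (2 * try_time)"
      proof (rule does_Seq[OF attempt[OF _ 2(2)]])
        fix R3 M3 assume 3: "\<And>k. k < 8 \<Longrightarrow> R3 k = R2 k"
          "found (if ((Q \<or> accepts True True (es ! i) (es ! j)) \<or> accepts True False (es ! i) (es ! j)) \<or>
             accepts False True (es ! i) (es ! j) then 1 else 0) M3"
        have ex: "accepting i j \<longleftrightarrow> accepts True True (es ! i) (es ! j) \<or> accepts True False (es ! i) (es ! j) \<or>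
            accepts False True (es ! i) (es ! j) \<or> accepts False False (es ! i) (es ! j)"
          unfolding accepting_def by (metis (full_types))
        show "does (try_prog False False) 8 (R3, M3) (found (if Q \<or> accepting i j then 1 else 0)) try_time"
          by (rule does_mono[OF attempt[OF _ 3(2)]]) (use 1(1) 2(1) 3(1) in \<open>simp_all add: ex disj_assoc\<close>)
      qed (use 1(1) 2(1) in simp_all)
    qed simp_all
  qed simp_all
qed

lemma search_does:
  assumes R: "env R" and M: "found 0 M"
  shows "does search_prog 6 (R, M) (found (if \<exists>i<m. \<exists>j<m. accepting i j then 1 else 0))
     (5 + m * (5 + m * (4 * try_time + 7) + 7))"
proof -
  let ?P = "\<lambda>i. \<exists>i'<i. \<exists>j<m. accepting i' j"
  let ?I = "\<lambda>i. found (if ?P i then 1 else 0)"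
  have "does search_prog 6 (R, M) (?I m) (5 + m * (5 + m * (4 * try_time + 7) + 7))"
    unfolding search_prog_def
  proof (rule does_for[where I = ?I])
    fix i R1 M1 assume 1: "i < m" "\<And>k. k < 6 \<Longrightarrow> R1 k = R k" "R1 6 = i" "?I i M1"
    have R1: "env R1" by (rule env_agree[OF R]) (simp add: 1(2))
    let ?J = "\<lambda>j. found (if ?P i \<or> (\<exists>j'<j. accepting i j') then 1 else 0)"
    have "does (for_loop 7 1 (Seq (try_prog True True) (Seq (try_prog True False)
       (Seq (try_prog False True) (try_prog False False))))) 7 (R1, M1) (?J m) (5 + m * (4 * try_time + 7))"
    proof (rule does_for[where I = ?J])
      fix j R2 M2 assume 2: "j < m" "\<And>k. k < 7 \<Longrightarrow> R2 k = R1 k" "R2 7 = j" "?J j M2"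
      have R2: "env R2" by (rule env_agree[OF R1]) (simp add: 2(2))
      have r6: "R2 6 = i" using 2(2) 1(3) by simp
      show "does (Seq (try_prog True True) (Seq (try_prog True False)
         (Seq (try_prog False True) (try_prog False False)))) (Suc 7) (R2, M2) (?J (Suc j)) (4 * try_time)"
        by (rule does_mono[OF tries_does[OF R2 r6 1(1) 2(3,1,4)]])
          (auto simp: less_Suc_eq split: if_splits)
    qed (use R1 env_simps 1(4) in auto)
    then show "does (for_loop 7 1 (Seq (try_prog True True) (Seq (try_prog True False)
       (Seq (try_prog False True) (try_prog False False))))) (Suc 6) (R1, M1) (?I (Suc i))
       (5 + m * (4 * try_time + 7))"
      by (rule does_mono) (auto simp: less_Suc_eq split: if_splits)
  qed (use R M env_simps in auto)
  then show ?thesis .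
qed

lemma input_lay: "snd (input_state n es) = lay 0 0 (\<lambda>_. 0) (\<lambda>_. 0)"
  by (auto simp: input_state_def lay_def fun_eq_iff)

lemma program_exec:
  "\<exists>t s. exec matching_cut_prog (input_state n es) t s \<and>
     fst s 0 = (if \<exists>i<m. \<exists>j<m. accepting i j then 1 else 0) \<and>
     t \<le> 30 + m * (5 + m * (4 * try_time + 7) + 7)"
proof -
  let ?M = "lay 0 0 (\<lambda>_. 0) (\<lambda>_. 0)"
  let ?R = "fst (input_state n es)"
  let ?R1 = "?R(2 := 2 * m)"
  let ?R2 = "?R1(3 := col_base)"
  let ?R3 = "?R2(4 := cnt_base)"
  let ?R4 = "?R3(5 := 3 * n)"
  have R: "?R 0 = n" "?R (Suc 0) = m" by (simp_all add: input_state_def)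
  have "exec (SetReg 2 (Plus (Reg 1) (Reg 1))) (?R, ?M) 4 (?R1, ?M)"
    using R by (intro exec_SetRegI) (simp_all add: mult_2)
  moreover have "exec (SetReg 3 (Plus (Reg 2) (Const 2))) (?R1, ?M) 4 (?R2, ?M)"
    using R by (intro exec_SetRegI) (simp_all add: col_base_def mult_2)
  moreover have "exec (SetReg 4 (Plus (Reg 3) (Reg 0))) (?R2, ?M) 4 (?R3, ?M)"
    using R by (intro exec_SetRegI) (simp_all add: cnt_base_def)
  moreover have "exec (SetReg 5 (Plus (Reg 0) (Plus (Reg 0) (Reg 0)))) (?R3, ?M) 6 (?R4, ?M)"
    using R by (intro exec_SetRegI) (simp_all add: numeral_3_eq_3 mult_2)
  moreover have env: "env ?R4" using R by (simp add: env_def)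
  have "found 0 ?M" unfolding found_def clean_def
    by (intro exI[of _ "0::nat"] exI[of _ "\<lambda>_. 0::nat"]) simp
  from search_does[OF env this] obtain t R5 M5 where
    5: "exec search_prog (?R4, ?M) t (R5, M5)" "t \<le> 5 + m * (5 + m * (4 * try_time + 7) + 7)"
      "\<forall>k<6. R5 k = ?R4 k" "found (if \<exists>i<m. \<exists>j<m. accepting i j then 1 else 0) M5"
    unfolding does_def by auto
  obtain ok c t' where M5: "M5 = lay (if \<exists>i<m. \<exists>j<m. accepting i j then 1 else 0) ok c t'"
    using 5(4) unfolding found_def by blast
  have "R5 2 = 2 * m" using 5(3) by simp
  then have "M5 (R5 2) = (if \<exists>i<m. \<exists>j<m. accepting i j then 1 else 0)"
    unfolding M5 by (simp only: lay_simps)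
  moreover have "exec (SetReg 0 (Mem (Reg 2))) (R5, M5) 3 (R5(0 := M5 (R5 2)), M5)"
    by (intro exec_SetRegI) simp_all
  ultimately have "exec matching_cut_prog (?R, ?M) (4 + (4 + (4 + (6 + (t + 3))))) (R5(0 := M5 (R5 2)), M5)"
    unfolding matching_cut_prog_def using 5(1) by (intro exec.Seq)
  moreover have "(?R, ?M) = input_state n es" by (metis input_lay prod.collapse)
  ultimately show ?thesis
    using 5(2) \<open>M5 (R5 2) = _\<close>
    by (intro exI[of _ "4 + (4 + (4 + (6 + (t + 3))))"] exI[of _ "(R5(0 := M5 (R5 2)), M5)"]) simp
qed

end

section \<open>Correctness of the propagation\<close>

definition extends :: "(nat \<Rightarrow> nat) \<Rightarrow> (nat \<Rightarrow> nat) \<Rightarrow> bool" where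
  "extends c c' \<longleftrightarrow> (\<forall>v. c v \<noteq> 0 \<longrightarrow> c' v = c v)"

lemma extends_refl: "extends c c"
  by (simp add: extends_def)

lemma extends_trans: "extends c c' \<Longrightarrow> extends c' c'' \<Longrightarrow> extends c c''"
  by (simp add: extends_def)

lemma extends_antisym:
  assumes "extends c c'" "extends c' c"
  shows "c = c'"
proof
  fix v show "c v = c' v" using assms unfolding extends_def by (cases "c v = 0") metis+
qed

lemma extends_push: "extends c (push_col n t x y c)"
  by (simp add: extends_def push_col_def)

lemma extends_push_cols: "extends c (push_cols n t xs c)"
proof (induction xs arbitrary: c)
  case Nil
  then show ?case by (simp add: push_cols_def extends_refl)
next
  case (Cons e xs)
  obtain x y where e: "e = (x, y)" by (cases e)
  have "push_cols n t (e # xs) c = push_cols n t xs (push_col n t y x (push_col n t x y c))"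
    by (simp add: push_cols_def e)
  then show ?case using Cons extends_push extends_trans by metis
qed

text \<open>Every push extends the coloring, so a sweep that ends where it began has changed nothing
  on the way.\<close>

lemma push_cols_fixed:
  assumes "push_cols n t xs c = c" "(x, y) \<in> darts xs"
  shows "push_col n t x y c = c"
  using assms
proof (induction xs)
  case Nil
  then show ?case by (simp add: darts_def)
next
  case (Cons e xs)
  obtain a b where e: "e = (a, b)" by (cases e)
  let ?c1 = "push_col n t a b c" and ?c2 = "push_col n t b a (push_col n t a b c)"
  have st: "push_cols n t xs ?c2 = c" using Cons.prems(1) by (simp add: push_cols_def e)
  have "extends ?c2 c" using extends_push_cols[of ?c2 n t xs] st by simp
  then have c1: "?c1 = c"
    using extends_antisym extends_push extends_trans by metis
  then have c2: "?c2 = c"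
    using extends_antisym extends_push \<open>extends ?c2 c\<close> by metis
  have "(x, y) = (a, b) \<or> (x, y) = (b, a) \<or> (x, y) \<in> darts xs"
    using Cons.prems(2) e by (auto simp: darts_def)
  then show ?case using c1 c2 Cons.IH st by auto
qed

lemma extends_vote: "extends c (vote_col n t c)"
  by (simp add: extends_def vote_col_def)

text \<open>A round that changes anything decides one of the \<open>n\<close> vertices. So
  \<open>n\<close> rounds always reach a fixed point, and the program needs no test for it.\<close>

lemma iterate_fixed:
  fixes f :: "(nat \<Rightarrow> nat) \<Rightarrow> nat \<Rightarrow> nat"
  assumes ext: "\<And>c. extends c (f c)" and low: "\<And>c v. v \<ge> n \<Longrightarrow> f c v = c v"
  shows "f ((f ^^ n) c) = (f ^^ n) c"
proof -
  define z where "z c = card {v. v < n \<and> c v = 0}" for c :: "nat \<Rightarrow> nat"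
  have dec: "z (f c) < z c" if ne: "f c \<noteq> c" for c
  proof -
    obtain v where v: "f c v \<noteq> c v" using ne by blast
    have "v < n" using low[of v c] v by (meson not_le)
    moreover have "c v = 0" using v ext[of c] unfolding extends_def by blast
    ultimately have "v \<in> {v. v < n \<and> c v = 0}" "v \<notin> {v. v < n \<and> f c v = 0}" using v by simp_all
    moreover have "{v. v < n \<and> f c v = 0} \<subseteq> {v. v < n \<and> c v = 0}"
      using ext[of c] by (fastforce simp: extends_def)
    ultimately have sub: "{v. v < n \<and> f c v = 0} \<subset> {v. v < n \<and> c v = 0}" by blast
    show ?thesis unfolding z_def by (rule psubset_card_mono[OF _ sub]) simp
  qed
  have "f ((f ^^ k) c) = (f ^^ k) c \<or> z ((f ^^ k) c) + k \<le> n" for k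
  proof (induction k)
    case 0
    have "z c \<le> card {..<n}" unfolding z_def by (rule card_mono) auto
    then show ?case by simp
  next
    case (Suc k)
    show ?case
    proof (cases "f ((f ^^ k) c) = (f ^^ k) c")
      case True then show ?thesis by simp
    next
      case False then show ?thesis using Suc dec[OF False] by simp
    qed
  qed
  \<comment> \<open>For \<open>k = n\<close> the second alternative says that nothing is undecided,
    and a further change would contradict \<open>dec\<close>.\<close>
  from this[of n] show ?thesis using dec[of "(f ^^ n) c"] by fastforce
qed

section \<open>Soundness and completeness of the search\<close>

locale matching_input = edge_input n es + common_neighbor_graph "{..<n}" "\<lambda>u w. (u, w) \<in> darts es" side
  for n es side
begin

lemma finite_D: "finite D"
  by (simp add: darts_def)

lemma D_sym: "(u, w) \<in> D \<Longrightarrow> (w, u) \<in> D"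
  by (auto simp: darts_def)

lemma n_pos: "(u, w) \<in> D \<Longrightarrow> 0 < n"
  using darts_less by fastforce

text \<open>Colors are multiples of \<open>n\<close> and vertices are below \<open>n\<close>, so the
  sum \<open>k + u\<close> determines both summands.\<close>

lemma tallies_eq:
  assumes c: "coloring c" and k: "k \<in> {0, n, 2 * n}" and u: "u < n"
  shows "tallies D c (k + u) = card {w. (u, w) \<in> D \<and> c w = k}"
proof -
  have "x = u \<and> c w = k" if "(x, w) \<in> D" "c w + x = k + u" for x w
  proof -
    have "c w \<in> {0, n, 2 * n}" "x < n" using c darts_less[OF that(1)] by (auto simp: coloring_def)
    then show ?thesis using that(2) k u by auto
  qed
  then have "{p \<in> D. c (snd p) + fst p = k + u} = Pair u ` {w. (u, w) \<in> D \<and> c w = k}"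
    by fastforce
  then show ?thesis unfolding tallies_def by (simp add: card_image inj_on_def)
qed

lemma finite_nbrs: "finite {w. (u, w) \<in> D \<and> P w}"
  by (rule finite_subset[of _ "snd ` D"]) (use finite_D in \<open>force+\<close>)

lemma tallies_gt1:
  assumes "coloring c" "k \<in> {0, n, 2 * n}" "u < n"
  shows "1 < tallies D c (k + u) \<longleftrightarrow> (\<exists>w w'. w \<noteq> w' \<and> (u, w) \<in> D \<and> (u, w') \<in> D \<and> c w = k \<and> c w' = k)"
  unfolding tallies_eq[OF assms]
  using card_le_Suc0_iff_eq[OF finite_nbrs, of u "\<lambda>w. c w = k"] by (auto simp: not_le[symmetric])

lemma tallies_pos:
  assumes "coloring c" "k \<in> {0, n, 2 * n}" "u < n"
  shows "0 < tallies D c (k + u) \<longleftrightarrow> (\<exists>w. (u, w) \<in> D \<and> c w = k)"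
  unfolding tallies_eq[OF assms] using finite_nbrs[of u "\<lambda>w. c w = k"] by (auto simp: card_gt_0_iff)

lemma code_opp: "3 * n - code n h = code n (\<not> h)" "code n h \<in> {0, n, 2 * n}"
  by (auto simp: code_def)

lemma code_inj: "0 < n \<Longrightarrow> code n h = code n h' \<longleftrightarrow> h = h'"
  by (auto simp: code_def)

lemma code_pos: "0 < n \<Longrightarrow> code n h \<noteq> 0"
  by (auto simp: code_def)

lemma extends_round: "extends c (round_col c)"
  unfolding round_col_def using extends_push_cols extends_vote extends_trans by metis

lemma extends_rounds: "extends c ((round_col ^^ k) c)"
  by (induction k) (auto intro: extends_refl extends_trans extends_round)

lemma push_cols_high:
  assumes "n \<le> v" "set xs \<subseteq> set es"
  shows "push_cols n t xs c v = c v"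
  using assms(2)
proof (induction xs arbitrary: c)
  case Nil
  then show ?case by (simp add: push_cols_def)
next
  case (Cons e xs)
  obtain x y where e: "e = (x, y)" by (cases e)
  have "x < n" "y < n" using Cons.prems edge_less[of x y] e by auto
  then have "push_col n t y x (push_col n t x y c) v = c v"
    using assms(1) by (auto simp: push_col_def)
  moreover have "push_cols n t (e # xs) c = push_cols n t xs (push_col n t y x (push_col n t x y c))"
    by (simp add: push_cols_def e)
  ultimately show ?case using Cons by simp
qed

lemma round_fixed: "round_col ((round_col ^^ n) c) = (round_col ^^ n) c"
  by (rule iterate_fixed[OF extends_round]) (simp add: round_col_def push_cols_high vote_col_def)

text \<open>However the coloring \<open>C\<close> arose, it is total and has passed the check. The
  colors of edge \<open>i\<close> survive propagation and filling, so this edge is cut.\<close>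

lemma accepts_sound:
  assumes acc: "accepts g d (es ! i) (es ! j)" and i: "i < m"
  shows "\<exists>\<sigma> a b. matching_coloring \<sigma> \<and> (a, b) \<in> D \<and> \<sigma> a \<noteq> \<sigma> b"
proof -
  obtain a b where ab: "es ! i = (a, b)" by (cases "es ! i")
  have abD: "(a, b) \<in> D" using i ab nth_mem[OF i] by (simp add: darts_def)
  have n: "0 < n" by (rule n_pos[OF abD])
  define C where "C = final_col g d (es ! i) (es ! j)"
  have C: "coloring C"
    unfolding C_def final_col_def by (intro coloring_fill coloring_rounds coloring_init)
  have nz: "C v \<noteq> 0" for v using n by (simp add: C_def final_col_def fill_col_def code_def)
  have Cv: "C v = code n (C v = n)" for v
  proof -
    have "C v \<in> {0, n, 2 * n}" using C unfolding coloring_def by blast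
    then show ?thesis using nz[of v] by (auto simp: code_def)
  qed
  have "a \<noteq> b" using edge_nth[OF i] ab by simp
  have "extends (init_col g (es ! i) (es ! j)) C"
    unfolding C_def final_col_def
    using extends_rounds by (auto simp: extends_def fill_col_def)
  then have Cab: "C a = n" "C b = 2 * n"
    using n \<open>a \<noteq> b\<close> by (auto simp: extends_def init_col_def ab code_def)
  have "matching_coloring (\<lambda>v. C v = n)"
    unfolding matching_coloring_def
  proof (intro allI impI)
    fix v u w
    assume D: "(v, u) \<in> D" "(v, w) \<in> D" and ne: "(C u = n) \<noteq> (C v = n)" "(C w = n) \<noteq> (C v = n)"
    have v: "v < n" using darts_less[OF D(1)] by simp
    have opp: "3 * n - C v = code n (C v \<noteq> n)" using Cv[of v] code_opp(1)[of "C v = n"] by simp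
    have "tallies D C (code n (C v \<noteq> n) + v) \<le> 1"
      using acc v unfolding accepts_def C_def[symmetric] by (simp add: opp[symmetric])
    then have "\<not> 1 < tallies D C (code n (C v \<noteq> n) + v)" by simp
    moreover have "C u = code n (C v \<noteq> n)" "C w = code n (C v \<noteq> n)"
      using Cv[of u] Cv[of w] ne by simp_all
    ultimately show "u = w" using tallies_gt1[OF C code_opp(2) v] D by blast
  qed
  moreover have "(C a = n) \<noteq> (C b = n)" using Cab n by simp
  ultimately show ?thesis using abD by (intro exI[of _ "\<lambda>v. C v = n"] exI[of _ a] exI[of _ b]) simp
qed

definition agrees :: "(nat \<Rightarrow> nat) \<Rightarrow> (nat \<Rightarrow> bool) \<Rightarrow> bool" where
  "agrees c \<tau> \<longleftrightarrow> (\<forall>v. c v \<noteq> 0 \<longrightarrow> v < n \<and> c v = code n (\<tau> v))"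

lemma agrees_coloring: "agrees c \<tau> \<Longrightarrow> coloring c"
  unfolding agrees_def coloring_def code_def by (metis insertCI)

text \<open>Two neighbors of the same color cannot both lie across the cut from
  \<open>u\<close>.\<close>

lemma agrees_vote:
  assumes v: "matching_coloring \<tau>" and c: "agrees c \<tau>" and n: "0 < n"
  shows "agrees (vote_col n (tallies D c) c) \<tau>"
proof -
  have key: "\<tau> u = h" if u: "u < n" and gt: "1 < tallies D c (code n h + u)" for u h
  proof -
    from gt obtain w w' where w: "w \<noteq> w'" "(u, w) \<in> D" "(u, w') \<in> D" "c w = code n h" "c w' = code n h"
      unfolding tallies_gt1[OF agrees_coloring[OF c] code_opp(2) u] by blast
    have "\<tau> w = h" "\<tau> w' = h" using c w code_pos[OF n] code_inj[OF n] unfolding agrees_def by metis+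
    then show ?thesis using matching_coloringD[OF v w(2,3)] w(1) by blast
  qed
  show ?thesis
    unfolding agrees_def
  proof (intro allI impI)
    fix u assume nz: "vote_col n (tallies D c) c u \<noteq> 0"
    consider "c u \<noteq> 0" | "c u = 0" "u < n" "1 < tallies D c (n + u)"
      | "c u = 0" "u < n" "\<not> 1 < tallies D c (n + u)" "1 < tallies D c (2 * n + u)"
      using nz by (auto simp: vote_col_def split: if_splits)
    then show "u < n \<and> vote_col n (tallies D c) c u = code n (\<tau> u)"
    proof cases
      case 1
      then show ?thesis using c by (auto simp: vote_col_def agrees_def)
    next
      case 2
      then show ?thesis using key[of u True] by (auto simp: vote_col_def code_def)
    next
      case 3
      then show ?thesis using key[of u False] by (auto simp: vote_col_def code_def)
    qed
  qed
qed

text \<open>The counters used by a round may be outdated: they count the coloring \<open>b\<close> from the start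
  of the round, which \<open>c\<close> extends.\<close>

lemma agrees_push:
  assumes v: "matching_coloring \<tau>" and b: "agrees b \<tau>" and bc: "extends b c" and c: "agrees c \<tau>"
    and n: "0 < n" and xy: "(x, y) \<in> D"
  shows "agrees (push_col n (tallies D b) x y c) \<tau>"
proof (cases "c y = 0 \<and> 0 < tallies D b (3 * n - c x + x) \<and> c x \<noteq> 0")
  case True
  then have cx: "x < n" "c x = code n (\<tau> x)" using c by (auto simp: agrees_def)
  with True have "0 < tallies D b (code n (\<not> \<tau> x) + x)" by (simp add: code_opp)
  then obtain w where w: "(x, w) \<in> D" "b w = code n (\<not> \<tau> x)"
    unfolding tallies_pos[OF agrees_coloring[OF b] code_opp(2) cx(1)] by blast
  have bw: "b w \<noteq> 0" using w(2) code_pos[OF n] by simp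
  then have tw: "\<tau> w = (\<not> \<tau> x)" using b w(2) code_inj[OF n] unfolding agrees_def by metis
  have "c w \<noteq> 0" using bc bw by (simp add: extends_def)
  \<comment> \<open>The vertex \<open>w\<close> was decided when the counters were taken and
    \<open>y\<close> is undecided now, so \<open>x y\<close> is not the cut edge at
    \<open>x\<close>.\<close>
  then have "y \<noteq> w" using True by auto
  then have "\<tau> y = \<tau> x" using same_color[OF v w(1) xy] tw by simp
  then have "c x = code n (\<tau> y)" "y < n" using cx darts_less[OF xy] by simp_all
  moreover have "push_col n (tallies D b) x y c = c(y := c x)" using True by (simp add: push_col_def)
  ultimately show ?thesis using c unfolding agrees_def by (metis fun_upd_apply)
next
  case False
  then have "push_col n (tallies D b) x y c = c" by (auto simp: push_col_def)
  then show ?thesis using c by simp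
qed

lemma agrees_push_cols:
  assumes v: "matching_coloring \<tau>" and b: "agrees b \<tau>" and n: "0 < n"
    and "extends b c" "agrees c \<tau>" "set xs \<subseteq> set es"
  shows "agrees (push_cols n (tallies D b) xs c) \<tau>"
  using assms(4-6)
proof (induction xs arbitrary: c)
  case Nil
  then show ?case by (simp add: push_cols_def)
next
  case (Cons e xs)
  obtain x y where e: "e = (x, y)" by (cases e)
  have xy: "(x, y) \<in> D" "(y, x) \<in> D" using Cons.prems(3) e by (auto simp: darts_def)
  let ?c1 = "push_col n (tallies D b) x y c"
  have e1: "extends b ?c1" using Cons.prems(1) extends_push extends_trans by blast
  have a1: "agrees ?c1 \<tau>" by (rule agrees_push[OF v b Cons.prems(1,2) n xy(1)])
  have "extends b (push_col n (tallies D b) y x ?c1)" using e1 extends_push extends_trans by blast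
  moreover have "agrees (push_col n (tallies D b) y x ?c1) \<tau>" by (rule agrees_push[OF v b e1 a1 n xy(2)])
  moreover have "push_cols n t (e # xs) c = push_cols n t xs (push_col n t y x (push_col n t x y c))" for t
    by (simp add: push_cols_def e)
  ultimately show ?case using Cons.IH Cons.prems(3) by simp
qed

lemma agrees_round: "matching_coloring \<tau> \<Longrightarrow> 0 < n \<Longrightarrow> agrees c \<tau> \<Longrightarrow> agrees (round_col c) \<tau>"
  unfolding round_col_def by (intro agrees_push_cols extends_vote agrees_vote) simp_all

lemma agrees_rounds: "matching_coloring \<tau> \<Longrightarrow> 0 < n \<Longrightarrow> agrees c \<tau> \<Longrightarrow> agrees ((round_col ^^ k) c) \<tau>"
  by (induction k) (auto intro: agrees_round)

text \<open>At a fixed point nothing changes within the round, so the counters are up to date, and a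
  forcing rule with an undecided conclusion would still color a vertex.\<close>

lemma forced_colored:
  assumes c: "agrees c \<tau>" and fp: "round_col c = c" and n: "0 < n"
    and S: "\<And>v. v \<in> S \<Longrightarrow> c v \<noteq> 0" and forced: "forced \<tau> S v"
  shows "c v \<noteq> 0"
proof -
  have "extends (vote_col n (tallies D c) c) c"
    using extends_push_cols[of "vote_col n (tallies D c) c" n "tallies D c" es] fp
    unfolding round_col_def by simp
  then have vote: "vote_col n (tallies D c) c = c"
    using extends_antisym extends_vote by metis
  then have "push_cols n (tallies D c) es c = c" using fp unfolding round_col_def by simp
  then have push: "push_col n (tallies D c) x y c = c" if "(x, y) \<in> D" for x y
    using push_cols_fixed that by blast
  have cc: "coloring c" by (rule agrees_coloring[OF c])
  have val: "u < n" "c u = code n (\<tau> u)" if "c u \<noteq> 0" for u using c that by (auto simp: agrees_def)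
  show ?thesis
    using forced
  proof (induction rule: forced.induct)
    case (base v)
    then show ?case by (rule S)
  next
    case (sat u w v)
    have "code n (\<not> \<tau> u) = c w" using val(2)[OF sat.IH(2)] sat.hyps by auto
    then have "0 < tallies D c (code n (\<not> \<tau> u) + u)"
      unfolding tallies_pos[OF cc code_opp(2) val(1)[OF sat.IH(1)]] using sat.hyps by metis
    then have "0 < tallies D c (3 * n - c u + u)" by (simp add: val(2)[OF sat.IH(1)] code_opp)
    with push[OF sat.hyps(5)] sat.IH(1) show ?case
      by (auto simp: push_col_def fun_eq_iff split: if_splits)
  next
    case (two u w v)
    have vn: "v < n" using darts_less[OF two.hyps(5)] by simp
    have "(v, u) \<in> D" "(v, w) \<in> D" using two.hyps D_sym by blast+
    moreover have "c u = code n (\<tau> u)" "c w = code n (\<tau> u)" 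
      using val(2)[OF two.IH(1)] val(2)[OF two.IH(2)] two.hyps(4) by (simp_all only:)
    ultimately have "1 < tallies D c (code n (\<tau> u) + v)"
      unfolding tallies_gt1[OF cc code_opp(2) vn] using two.hyps by blast
    then have "vote_col n (tallies D c) c v \<noteq> 0"
      using n vn by (auto simp: vote_col_def code_def split: if_splits)
    then show ?case by (simp add: vote)
  qed
qed

text \<open>The rules only compare colors, so swapping the two colors does not affect them.\<close>

lemma forced_cong:
  assumes "\<And>u w. (\<sigma> u = \<sigma> w) = (\<tau> u = \<tau> w)" "forced \<sigma> S v"
  shows "forced \<tau> S v"
  using assms(2)
proof (induction rule: forced.induct)
  case (sat u w v)
  then show ?case using forced.sat[of \<tau> S u w v] assms(1) by blast
next
  case (two u w v)
  then show ?case using forced.two[of \<tau> S u w v] assms(1) by blast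
qed (rule forced.base)

lemma accepts_complete:
  assumes two_edges_suffice
  shows "\<exists>i<m. \<exists>j<m. accepting i j"
proof -
  from assms obtain \<sigma> a b a' b' d where v: "matching_coloring \<sigma>" and ab: "(a, b) \<in> D" "\<sigma> a \<noteq> \<sigma> b"
    and ab': "(a', b') \<in> D" "\<sigma> a' \<noteq> \<sigma> b'"
    and cover: "\<forall>x\<in>{..<n}. forced \<sigma> {a, b, a', b'} x \<or> \<sigma> x = d"
    unfolding two_edges_suffice_def by blast
  have n: "0 < n" by (rule n_pos[OF ab(1)])
  have ends: "\<exists>i<m. {fst (es ! i), snd (es ! i)} = {x, y}" if "(x, y) \<in> D" for x y
  proof -
    have "(x, y) \<in> set es \<or> (y, x) \<in> set es" using that by (auto simp: darts_def)
    then obtain k where "k < m" "es ! k = (x, y) \<or> es ! k = (y, x)" unfolding in_set_conv_nth by blast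
    then show ?thesis by (intro exI[of _ k]) auto
  qed
  obtain i where i: "i < m" "{fst (es ! i), snd (es ! i)} = {a, b}" using ends[OF ab(1)] by blast
  obtain j where j: "j < m" "{fst (es ! j), snd (es ! j)} = {a', b'}" using ends[OF ab'(1)] by blast
  let ?e = "es ! i" and ?e' = "es ! j"
  \<comment> \<open>This is \<open>\<sigma>\<close>, with the colors swapped if necessary so that
    the first end of \<open>?e\<close> has the color assigned by \<open>init_col\<close>. The
    guesses \<open>g\<close> and \<open>h\<close> are the second edge's orientation and the default
    color after this swap.\<close>
  define \<tau> where "\<tau> x \<longleftrightarrow> \<sigma> x = \<sigma> (fst ?e)" for x
  have eq: "(\<sigma> u = \<sigma> w) = (\<tau> u = \<tau> w)" for u w unfolding \<tau>_def by blast
  have vt: "matching_coloring \<tau>" using v unfolding matching_coloring_def eq .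
  have ce: "\<sigma> (fst ?e) \<noteq> \<sigma> (snd ?e)" using i ab(2) by (metis doubleton_eq_iff)
  have ce': "\<sigma> (fst ?e') \<noteq> \<sigma> (snd ?e')" using j ab'(2) by (metis doubleton_eq_iff)
  define g where "g = \<tau> (fst ?e')"
  have te: "\<tau> (fst ?e)" "\<not> \<tau> (snd ?e)" "\<tau> (snd ?e') = (\<not> g)"
    using ce ce' unfolding \<tau>_def g_def by auto
  let ?c0 = "init_col g ?e ?e'"
  define F where "F = (round_col ^^ n) ?c0"
  have a0: "agrees ?c0 \<tau>"
    unfolding agrees_def
  proof (intro allI impI)
    fix u assume "?c0 u \<noteq> 0"
    then consider "u = snd ?e" | "u \<noteq> snd ?e" "u = fst ?e"
      | "u \<noteq> snd ?e" "u \<noteq> fst ?e" "u = snd ?e'"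
      | "u \<noteq> snd ?e" "u \<noteq> fst ?e" "u \<noteq> snd ?e'" "u = fst ?e'"
      by (auto simp: init_col_def split: if_splits)
    then show "u < n \<and> ?c0 u = code n (\<tau> u)"
      using edge_nth[OF i(1)] edge_nth[OF j(1)] te
      by cases (simp_all add: init_col_def g_def)
  qed
  have aF: "agrees F \<tau>" unfolding F_def by (rule agrees_rounds[OF vt n a0])
  have nz: "F u \<noteq> 0" if "u \<in> {a, b, a', b'}" for u
  proof -
    have "u \<in> {fst ?e, snd ?e, fst ?e', snd ?e'}" using that i j by auto
    then have "?c0 u \<noteq> 0" using code_pos[OF n] by (auto simp: init_col_def)
    then show ?thesis using extends_rounds[of ?c0 n] unfolding F_def extends_def by simp
  qed
  have fp: "round_col F = F" unfolding F_def by (rule round_fixed)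
  define h where "h \<longleftrightarrow> d = \<sigma> (fst ?e)"
  let ?C = "final_col g h ?e ?e'"
  have C: "?C v = code n (\<tau> v)" if "v < n" for v
  proof (cases "F v = 0")
    case True
    then have "\<not> forced \<tau> {a, b, a', b'} v" using forced_colored[OF aF fp n nz] by blast
    then have "\<not> forced \<sigma> {a, b, a', b'} v" using forced_cong[of \<sigma> \<tau> _ v, OF eq] by blast
    then have "\<sigma> v = d" using cover that by blast
    then show ?thesis using True unfolding final_col_def F_def[symmetric]
      by (simp add: fill_col_def \<tau>_def h_def)
  next
    case False
    then show ?thesis using aF unfolding final_col_def F_def[symmetric]
      by (simp add: fill_col_def agrees_def)
  qed
  have cC: "coloring ?C"
    unfolding final_col_def by (intro coloring_fill coloring_rounds coloring_init)
  have "accepts g h ?e ?e'"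
    unfolding accepts_def
  proof (intro allI impI)
    fix u assume u: "u < n"
    have "\<not> 1 < tallies D ?C (code n (\<not> \<tau> u) + u)"
      unfolding tallies_gt1[OF cC code_opp(2) u]
    proof (intro notI, elim exE conjE)
      fix w w' assume w: "w \<noteq> w'" "(u, w) \<in> D" "(u, w') \<in> D"
        "?C w = code n (\<not> \<tau> u)" "?C w' = code n (\<not> \<tau> u)"
      have "\<tau> w \<noteq> \<tau> u" "\<tau> w' \<noteq> \<tau> u"
        using C[of w] C[of w'] w darts_less[OF w(2)] darts_less[OF w(3)] code_inj[OF n] by auto
      then show False using matching_coloringD[OF vt w(2,3)] w(1) by blast
    qed
    then show "tallies D ?C (3 * n - ?C u + u) \<le> 1" by (simp add: C[OF u] code_opp)
  qed
  then show ?thesis using i(1) j(1) unfolding accepting_def by blast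
qed

lemma accepting_iff:
  assumes "\<And>u. u < n \<Longrightarrow> \<exists>w. (u, w) \<in> D"
  shows "(\<exists>i<m. \<exists>j<m. accepting i j) \<longleftrightarrow> (\<exists>\<sigma> a b. matching_coloring \<sigma> \<and> (a, b) \<in> D \<and> \<sigma> a \<noteq> \<sigma> b)"
proof
  assume "\<exists>i<m. \<exists>j<m. accepting i j"
  then obtain i j g d where "accepts g d (es ! i) (es ! j)" "i < m" unfolding accepting_def by blast
  then show "\<exists>\<sigma> a b. matching_coloring \<sigma> \<and> (a, b) \<in> D \<and> \<sigma> a \<noteq> \<sigma> b" by (rule accepts_sound)
next
  assume "\<exists>\<sigma> a b. matching_coloring \<sigma> \<and> (a, b) \<in> D \<and> \<sigma> a \<noteq> \<sigma> b"
  then obtain \<sigma> a b where "matching_coloring \<sigma>" "(a, b) \<in> D" "\<sigma> a \<noteq> \<sigma> b" by blast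
  then have two_edges_suffice by (rule matching_cut_suffices) (use assms in simp)
  then show "\<exists>i<m. \<exists>j<m. accepting i j" by (rule accepts_complete)
qed

end

section \<open>Translation from graphs and cuts to darts and colorings\<close>

lemma successively_crossing:
  assumes "successively R p" "p \<noteq> []" "P (hd p)" "\<not> P (last p)"
  shows "\<exists>x y. R x y \<and> P x \<and> \<not> P y"
  using assms
proof (induction p)
  case (Cons x p)
  then show ?case
    by (cases p; cases "P (hd p)") (auto split: if_splits)
qed simp

lemma darts_iff:
  assumes "edge_list E es"
  shows "(u, w) \<in> darts es \<longleftrightarrow> {u, w} \<in> E"
proof -
  have E: "E = (\<lambda>(u, v). {u, v}) ` set es" using assms by (simp add: edge_list_def)
  show ?thesis
  proof
    assume "(u, w) \<in> darts es"
    then have "(u, w) \<in> set es \<or> (w, u) \<in> set es" by (auto simp: darts_def)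
    then show "{u, w} \<in> E" unfolding E by (force simp: insert_commute)
  next
    assume "{u, w} \<in> E"
    then obtain a b where "(a, b) \<in> set es" "{u, w} = {a, b}" unfolding E by auto
    then show "(u, w) \<in> darts es" by (auto simp: darts_def doubleton_eq_iff)
  qed
qed

lemma short_path:
  assumes V: "finite V" and con: "graph_connected V E" and diam: "diameter V E \<le> 3"
    and uv: "u \<in> V" "v \<in> V"
  obtains p where "graph_path V E u p v" "length p \<le> 4"
proof -
  obtain q where q: "graph_path V E u q v" using con uv by (auto simp: graph_connected_def)
  then have "\<exists>q'. graph_path V E u q' v \<and> length q' = Suc (length q - 1)"
    by (intro exI[of _ q]) (simp add: graph_path_def)
  then have "\<exists>p. graph_path V E u p v \<and> length p = Suc (graph_dist V E u v)"
    unfolding graph_dist_def by (rule LeastI)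
  moreover have "{graph_dist V E u v | u v. u \<in> V \<and> v \<in> V} =
      (\<lambda>(u, v). graph_dist V E u v) ` (V \<times> V)" by auto
  then have "graph_dist V E u v \<le> diameter V E"
    unfolding diameter_def using uv V by (intro Max_ge) auto
  ultimately show thesis using that diam by fastforce
qed

lemma matching_input_exists:
  assumes g: "simple_graph {..<n} E" and bip: "bipartite {..<n} E"
    and con: "graph_connected {..<n} E" and diam: "diameter {..<n} E \<le> 3"
    and es: "edge_list E es"
  shows "\<exists>side. matching_input n es side"
proof -
  from bip obtain A B where AB: "A \<union> B = {..<n}" "A \<inter> B = {}" "\<forall>e\<in>E. \<exists>a\<in>A. \<exists>b\<in>B. e = {a, b}"
    unfolding bipartite_def by (elim exE conjE)
  have D: "(u, w) \<in> darts es \<longleftrightarrow> {u, w} \<in> E" for u w by (rule darts_iff[OF es])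
  have edge: "u < n \<and> w < n \<and> u \<noteq> w \<and> (u \<in> A) \<noteq> (w \<in> A)" if uw: "{u, w} \<in> E" for u w
  proof -
    obtain a b where ab: "a \<in> A" "b \<in> B" "{u, w} = {a, b}" using bspec[OF AB(3) uw] by blast
    then have "b \<notin> A" "a < n" "b < n" using AB(1,2) by auto
    then show ?thesis using ab by (auto simp: doubleton_eq_iff)
  qed
  have "matching_input n es (\<lambda>v. v \<in> A)"
  proof unfold_locales
    fix u v
    show "u < n \<and> v < n \<and> u \<noteq> v" if "(u, v) \<in> set es"
    proof -
      have "(u, v) \<in> darts es" using that by (simp add: darts_def)
      then show ?thesis using edge D by blast
    qed
    show "distinct (map (\<lambda>(u, v). {u, v}) es)" using es by (simp add: edge_list_def)
    show "(v, u) \<in> darts es" if "(u, v) \<in> darts es" using that by (simp add: D insert_commute)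
    show "u \<in> {..<n}" if "(u, v) \<in> darts es" using that edge by (simp add: D)
    show "(u \<in> A) \<noteq> (v \<in> A)" if "(u, v) \<in> darts es" using that edge by (simp add: D)
    assume uv: "u \<in> {..<n}" "v \<in> {..<n}" "(u \<in> A) = (v \<in> A)" "u \<noteq> v"
    obtain p where p: "graph_path {..<n} E u p v" "length p \<le> 4"
      using short_path[OF _ con diam uv(1,2)] by blast
    have *: "p \<noteq> []" "hd p = u" "last p = v" "successively (\<lambda>x y. {x, y} \<in> E) p"
      using p(1) by (auto simp: graph_path_def)
    \<comment> \<open>Sides alternate along \<open>p\<close>, so with different ends on one side it
      has exactly 3 vertices, and the middle one is the common neighbor.\<close>
    consider x where "p = [x]" | x y where "p = [x, y]" | x y z where "p = [x, y, z]"
      | x y z w where "p = [x, y, z, w]"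
      using p(2) *(1) by (auto simp: eval_nat_numeral le_Suc_eq length_Suc_conv)
    then show "\<exists>w. (u, w) \<in> darts es \<and> (v, w) \<in> darts es"
    proof cases
      case 1
      then show ?thesis using * uv by simp
    next
      case 2
      then show ?thesis using * uv(3) edge[of u v] by simp
    next
      case (3 x y z)
      then have "{u, y} \<in> E" "{v, y} \<in> E" using * by (auto simp: insert_commute)
      then show ?thesis using D by blast
    next
      case (4 x y z w)
      then have "{u, y} \<in> E" "{y, z} \<in> E" "{z, v} \<in> E" using * by auto
      then show ?thesis using edge uv(3) by metis
    qed
  qed
  then show ?thesis by (rule exI[of _ "\<lambda>v. v \<in> A"])
qed

text \<open>A path between the two non-empty parts crosses the cut, so there is a cut edge;
  conversely the ends of a cut edge witness that both parts are non-empty.\<close>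

lemma (in matching_input) has_matching_cut_iff:
  assumes con: "graph_connected {..<n} E" and es: "edge_list E es"
  shows "has_matching_cut {..<n} E \<longleftrightarrow> (\<exists>\<sigma> a b. matching_coloring \<sigma> \<and> (a, b) \<in> D \<and> \<sigma> a \<noteq> \<sigma> b)"
proof
  note DE = darts_iff[OF es]
  assume "has_matching_cut {..<n} E"
  then obtain X Y where cut: "X \<union> Y = {..<n}" "X \<inter> Y = {}" "X \<noteq> {}" "Y \<noteq> {}"
    and dis: "disjoint (cut_edges E X Y)"
    unfolding has_matching_cut_def matching_cut_def is_cut_def by blast
  obtain x y where xy: "x \<in> X" "y \<in> Y" using cut by blast
  have "x \<in> {..<n}" "y \<in> {..<n}" "y \<notin> X" using xy cut(1,2) by blast+
  then obtain p where p: "graph_path {..<n} E x p y" using con unfolding graph_connected_def by blast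
  then have "\<exists>a b. {a, b} \<in> E \<and> a \<in> X \<and> \<not> b \<in> X"
    using successively_crossing[of "\<lambda>a b. {a, b} \<in> E" p "\<lambda>v. v \<in> X"] xy(1) \<open>y \<notin> X\<close>
    by (simp add: graph_path_def)
  then obtain a b where ab: "{a, b} \<in> E" "a \<in> X" "b \<notin> X" by blast
  have "matching_coloring (\<lambda>v. v \<in> X)"
    unfolding matching_coloring_def
  proof (intro allI impI)
    fix v u w
    assume D: "(v, u) \<in> D" "(v, w) \<in> D" and ne: "(u \<in> X) \<noteq> (v \<in> X)" "(w \<in> X) \<noteq> (v \<in> X)"
    have cross: "{v, z} \<in> cut_edges E X Y" if "(v, z) \<in> D" "(z \<in> X) \<noteq> (v \<in> X)" for z
    proof -
      have "v \<in> X \<union> Y" "z \<in> X \<union> Y" using cut(1) darts_less[OF that(1)] by auto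
      then have "v \<in> X \<and> z \<in> Y \<or> z \<in> X \<and> v \<in> Y" using that(2) by blast
      then show ?thesis using that(1) unfolding cut_edges_def DE by (auto simp: insert_commute)
    qed
    have "{v, u} \<noteq> {v, w} \<Longrightarrow> {v, u} \<inter> {v, w} = {}"
      by (rule disjointD[OF dis cross[OF D(1) ne(1)] cross[OF D(2) ne(2)]])
    then have "{v, u} = {v, w}" by blast
    then show "u = w" by (auto simp: doubleton_eq_iff)
  qed
  then show "\<exists>\<sigma> a b. matching_coloring \<sigma> \<and> (a, b) \<in> D \<and> \<sigma> a \<noteq> \<sigma> b"
    using ab by (intro exI[of _ "\<lambda>v. v \<in> X"] exI[of _ a] exI[of _ b]) (simp add: DE)
next
  note DE = darts_iff[OF es]
  assume "\<exists>\<sigma> a b. matching_coloring \<sigma> \<and> (a, b) \<in> D \<and> \<sigma> a \<noteq> \<sigma> b"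
  then obtain \<sigma> a b where v: "matching_coloring \<sigma>" and ab: "(a, b) \<in> D" "\<sigma> a \<noteq> \<sigma> b" by blast
  let ?X = "{v. v < n \<and> \<sigma> v}" and ?Y = "{v. v < n \<and> \<not> \<sigma> v}"
  have "is_cut {..<n} ?X ?Y"
    using darts_less[OF ab(1)] ab(2) unfolding is_cut_def by auto
  moreover have "disjoint (cut_edges E ?X ?Y)"
    unfolding disjoint_def
  proof (intro ballI impI)
    fix e e' assume "e \<in> cut_edges E ?X ?Y" "e' \<in> cut_edges E ?X ?Y" and ne: "e \<noteq> e'"
    then obtain x y x' y' where e: "{x, y} \<in> E" "\<sigma> x" "\<not> \<sigma> y" "e = {x, y}"
      and e': "{x', y'} \<in> E" "\<sigma> x'" "\<not> \<sigma> y'" "e' = {x', y'}"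
      unfolding cut_edges_def by blast
    have D: "(x, y) \<in> D" "(y, x) \<in> D" "(x', y') \<in> D" "(y', x') \<in> D"
      using e(1) e'(1) by (simp_all add: DE insert_commute)
    have "x \<noteq> x'"
      using matching_coloringD[OF v D(1), of y'] D(3) e e' ne by auto
    moreover have "y \<noteq> y'"
      using matching_coloringD[OF v D(2), of x'] D(4) e e' ne by auto
    moreover have "x \<noteq> y'" "y \<noteq> x'" using e e' by auto
    ultimately show "e \<inter> e' = {}" using e(4) e'(4) by auto
  qed
  ultimately show "has_matching_cut {..<n} E"
    unfolding has_matching_cut_def matching_cut_def by blast
qed

lemma nonisolated:
  assumes con: "graph_connected {..<n} E" and es: "edge_list E es" and n: "2 \<le> n" and u: "u < n"
  shows "\<exists>w. (u, w) \<in> darts es"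
proof -
  define v where "v = (if u = 0 then 1 else 0 :: nat)"
  have v: "v < n" "v \<noteq> u" using n by (auto simp: v_def)
  obtain p where p: "graph_path {..<n} E u p v" using con u v by (auto simp: graph_connected_def)
  obtain a b where "{a, b} \<in> E \<and> a = u \<and> \<not> b = u"
    using successively_crossing[of "\<lambda>x y. {x, y} \<in> E" p "\<lambda>x. x = u"] p v(2)
    by (auto simp: graph_path_def)
  then show ?thesis using darts_iff[OF es] by blast
qed

lemma vertices_le_edges:
  assumes "\<And>u. u < n \<Longrightarrow> \<exists>w. (u, w) \<in> darts es"
  shows "n \<le> 2 * length es"
proof -
  have "{..<n} \<subseteq> fst ` set es \<union> snd ` set es"
  proof
    fix u assume "u \<in> {..<n}"
    then obtain w where "(u, w) \<in> darts es" using assms by auto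
    then show "u \<in> fst ` set es \<union> snd ` set es" by (force simp: darts_def)
  qed
  then have "card {..<n} \<le> card (fst ` set es \<union> snd ` set es)" by (intro card_mono) auto
  also have "\<dots> \<le> card (fst ` set es) + card (snd ` set es)" by (rule card_Un_le)
  also have "\<dots> \<le> card (set es) + card (set es)" by (intro add_mono card_image_le) auto
  also have "\<dots> \<le> 2 * length es" using card_length[of es] by simp
  finally show ?thesis by simp
qed

text \<open>The hypotheses give \<open>n + 1 \<le> 2 * n\<close> and
  \<open>n + m + 1 \<le> 4 * m\<close>, hence 32000 for the main term; the lower terms add at most
  49.\<close>

lemma time_bound:
  fixes n m :: nat
  assumes "1 \<le> n" "1 \<le> m" "n \<le> 2 * m"
  shows "30 + m * (5 + m * (4 * (1000 * (n + 1) * (n + m + 1)) + 7) + 7) \<le> 40000 * (n * m ^ 3)"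
proof -
  have "(n + 1) * (n + m + 1) \<le> (2 * n) * (4 * m)" using assms by (intro mult_le_mono) auto
  then have "4000 * ((n + 1) * (n + m + 1)) \<le> 4000 * ((2 * n) * (4 * m))" by (rule mult_le_mono2)
  moreover have "4 * (1000 * (n + 1) * (n + m + 1)) = 4000 * ((n + 1) * (n + m + 1))"
    by (simp only: mult.assoc[symmetric])
  moreover have "4000 * ((2 * n) * (4 * m)) = 32000 * (n * m)" by simp
  ultimately have "4 * (1000 * (n + 1) * (n + m + 1)) \<le> 32000 * (n * m)" by (simp only:)
  then have "m * (m * (4 * (1000 * (n + 1) * (n + m + 1)))) \<le> m * (m * (32000 * (n * m)))"
    by (intro mult_le_mono2)
  also have "\<dots> = 32000 * (n * m ^ 3)" by (simp add: power3_eq_cube)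
  finally have a: "m * (m * (4 * (1000 * (n + 1) * (n + m + 1)))) \<le> 32000 * (n * m ^ 3)" .
  have "m ^ k \<le> n * m ^ 3" if "k \<le> 3" for k
    using mult_le_mono[OF assms(1) power_increasing[OF that assms(2)]] by simp
  from this[of 0] this[of 1] this[of 2]
  have "1 \<le> n * m ^ 3" "m \<le> n * m ^ 3" "m ^ 2 \<le> n * m ^ 3" by (simp_all only: power_0 power_one_right)
  then have "30 + 12 * m + 7 * m ^ 2 \<le> 49 * (n * m ^ 3)" by linarith
  moreover have "30 + m * (5 + m * (4 * (1000 * (n + 1) * (n + m + 1)) + 7) + 7) =
      30 + 12 * m + 7 * m ^ 2 + m * (m * (4 * (1000 * (n + 1) * (n + m + 1))))"
    by (simp add: algebra_simps power2_eq_square)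
  ultimately show ?thesis using a by linarith
qed

theorem theorem3:
  "solvable_in_time
     (\<lambda>V E. bipartite V E \<and> graph_connected V E \<and> diameter V E \<le> 3)
     has_matching_cut
     (\<lambda>n m. n * m ^ 3)"
  unfolding solvable_in_time_def
proof (rule exI[of _ matching_cut_prog], rule exI[of _ 40000], intro allI impI, elim conjE)
  fix n E es
  assume g: "simple_graph {..<n} E" and bip: "bipartite {..<n} E"
    and con: "graph_connected {..<n} E" and diam: "diameter {..<n} E \<le> 3"
    and es: "edge_list E es"
  obtain side where "matching_input n es side"
    using matching_input_exists[OF g bip con diam es] by blast
  then interpret matching_input n es side .
  have n: "1 \<le> n" using con by (auto simp: graph_connected_def Suc_le_eq)
  have card: "card E = m"
    using es distinct_card[of "map (\<lambda>(u, v). {u, v}) es"] by (simp add: edge_list_def)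
  have res: "(\<exists>i<m. \<exists>j<m. accepting i j) = has_matching_cut {..<n} E \<and>
      30 + m * (5 + m * (4 * try_time + 7) + 7) \<le> 40000 * max 1 (n * m ^ 3)"
  proof (cases "2 \<le> n")
    case True
    have iso: "\<exists>w. (u, w) \<in> D" if "u < n" for u by (rule nonisolated[OF con es True that])
    have nm: "n \<le> 2 * m" by (rule vertices_le_edges[OF iso])
    have "1 \<le> m" using n nm by linarith
    then have "30 + m * (5 + m * (4 * try_time + 7) + 7) \<le> 40000 * (n * m ^ 3)"
      using time_bound[OF n _ nm] unfolding try_time_def by blast
    also have "\<dots> \<le> 40000 * max 1 (n * m ^ 3)" by (intro mult_le_mono2) simp
    finally have time: "30 + m * (5 + m * (4 * try_time + 7) + 7) \<le> 40000 * max 1 (n * m ^ 3)" .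
    have "(\<exists>i<m. \<exists>j<m. accepting i j) = has_matching_cut {..<n} E"
      unfolding has_matching_cut_iff[OF con es] by (rule accepting_iff[OF iso])
    then show ?thesis using time by (rule conjI)
  next
    case False
    \<comment> \<open>With one vertex there is no cut, and without edges the search does nothing.
      Here \<open>n * m ^ 3\<close> is 0, so the constant time is covered by
      \<open>max 1\<close>.\<close>
    then have n1: "n = 1" using n by simp
    have m0: "m = 0"
    proof (rule ccontr)
      assume "m \<noteq> 0"
      then show False using edge_nth[of 0] n1 by auto
    qed
    have "\<not> is_cut {..<n} X Y" for X Y
    proof
      assume "is_cut {..<n} X Y"
      then have "X \<union> Y = {0}" "X \<noteq> {}" "Y \<noteq> {}" "X \<inter> Y = {}"
        using n1 by (auto simp: is_cut_def)
      then have "X = {0}" "Y = {0}" by (simp_all add: Un_singleton_iff)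
      then show False using \<open>X \<inter> Y = {}\<close> by simp
    qed
    then have "\<not> has_matching_cut {..<n} E" by (simp add: has_matching_cut_def matching_cut_def)
    then show ?thesis by (simp add: m0)
  qed
  obtain t s where run: "exec matching_cut_prog (input_state n es) t s"
      "fst s 0 = (if \<exists>i<m. \<exists>j<m. accepting i j then 1 else 0)"
      "t \<le> 30 + m * (5 + m * (4 * try_time + 7) + 7)"
    using program_exec by blast
  show "\<exists>t s. exec matching_cut_prog (input_state n es) t s \<and>
      fst s 0 = (if has_matching_cut {..<n} E then 1 else 0) \<and>
      t \<le> 40000 * max 1 (n * card E ^ 3)"
    unfolding card
  proof (intro exI conjI)
    show "exec matching_cut_prog (input_state n es) t s" by (rule run(1))
    show "fst s 0 = (if has_matching_cut {..<n} E then 1 else 0)"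
      using run(2) unfolding conjunct1[OF res] .
    show "t \<le> 40000 * max 1 (n * m ^ 3)" by (rule le_trans[OF run(3) conjunct2[OF res]])
  qed
qed

end
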